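(* Let $\mathbf r:U\to\mathbb R^3$ be a pseudospherical surface in Dini's parameterisation with Chebyshev angle $\phi$ and unit normal $\mathbf n$, and let $\mathbf c\in\mathbb R^3$ be a constant vector. The first member $(\mathcal R+\mathrm{Id})^{-1}(\mathbf n\cdot\mathbf c)$ of the negative $\mathcal R+\mathrm{Id}$ hierarchy coincides with $$\tilde\Phi_1=\mathbf n\cdot\mathbf q_1,$$ where $\mathbf q_1:U\to\mathbb R^3$ is determined (up to an additive constant vector) by $$\mathbf q_{1,x}=-\frac{\mathbf r_y}{\sin\phi}\Big(\mathbf n-\frac{\phi_x}{\sin\phi}\mathbf n_y\Big)\cdot\mathbf c,\qquad \mathbf q_{1,y}=\frac{\mathbf r_x}{\sin\phi}\Big(\mathbf n-\frac{\phi_y}{\sin\phi}\mathbf n_x\Big)\cdot\mathbf c .$$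
   Context: All functions are smooth; $U\subset\mathbb R^2$ is a connected, simply connected open set with coordinates $x,y$. In the displayed formulas the scalar product with $\mathbf c$ applies to the bracketed vector, giving a scalar that multiplies $\mathbf r_y/\sin\phi$, respectively $\mathbf r_x/\sin\phi$; $\mathbf q_{1,x},\mathbf q_{1,y}$ are partial derivatives of $\mathbf q_1$. A pseudospherical surface in Dini's parameterisation with Chebyshev angle $\phi$ is a map $\mathbf r:U\to\mathbb R^3$ with unit normal $\mathbf n$ whose fundamental forms are $\mathrm I=dx^2+2\cos\phi\,dx\,dy+dy^2$, $\mathrm{II}=2\sin\phi\,dx\,dy$, where $\sin\phi\neq0$ on $U$. Equivalently, $\phi_{xy}=\sin\phi$ and $$\mathbf r_{xx}=\tfrac{\phi_x}{\tan\phi}\mathbf r_x-\tfrac{\phi_x}{\sin\phi}\mathbf r_y,\quad \mathbf r_{xy}=\sin\phi\,\mathbf n,\quad \mathbf r_{yy}=-\tfrac{\phi_y}{\sin\phi}\mathbf r_x+\tfrac{\phi_y}{\tan\phi}\mathbf r_y,$$ $$\mathbf n_x=\tfrac1{\tan\phi}\mathbf r_x-\tfrac1{\sin\phi}\mathbf r_y,\quad \mathbf n_y=\tfrac1{\tan\phi}\mathbf r_y-\tfrac1{\sin\phi}\mathbf r_x .$$ $\mathcal R$ is the multivalued recursion operator acting on solutions $\Phi$ of $\Phi_{xy}=\Phi\cos\phi$ by $\mathcal R\Phi=\Phi_{xx}+\phi_xQ$, where $Q$ is any function with $Q_x=\Phi_x\phi_x$, $Q_y=\Phi\sin\phi$.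 The inverse is taken in the sense of relations: $\Phi$ is a value of $(\mathcal R+\mathrm{Id})^{-1}\Psi$ if $\Phi_{xy}=\Phi\cos\phi$ and $\Psi=\Phi_{xx}+\phi_xQ+\Phi$ for some such $Q$. The function $\tilde\Phi_0=\mathbf n\cdot\mathbf c$ is a solution of the Moutard equation $\Phi_{xy}=\Phi\cos\phi$ and is called the starting member of the negative $\mathcal R+\mathrm{Id}$ hierarchy; its next member is $(\mathcal R+\mathrm{Id})^{-1}\tilde\Phi_0$. "Coincides" means that the values of the multivalued expression $(\mathcal R+\mathrm{Id})^{-1}(\mathbf n\cdot\mathbf c)$ are exactly the functions $\mathbf n\cdot\mathbf q_1$ for all solutions $\mathbf q_1$ of the displayed system. *)

theory Defs
  imports "HOL-Analysis.Analysis"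
begin

text \<open>The plane is \<open>real \<times> real\<close>. All functions are total; only their values on the
  open set \<open>U\<close> matter, so equations between functions are stated pointwise on \<open>U\<close>.\<close>

definition partial_x :: "(real \<times> real \<Rightarrow> 'a::real_normed_vector) \<Rightarrow> real \<times> real \<Rightarrow> 'a"
    (\<open>\<partial>\<^sub>x\<close>)
  where "\<partial>\<^sub>x f = (\<lambda>(x, y). vector_derivative (\<lambda>t. f (t, y)) (at x))"

definition partial_y :: "(real \<times> real \<Rightarrow> 'a::real_normed_vector) \<Rightarrow> real \<times> real \<Rightarrow> 'a"
    (\<open>\<partial>\<^sub>y\<close>)
  where "\<partial>\<^sub>y f = (\<lambda>(x, y). vector_derivative (\<lambda>t. f (x, t)) (at y))"

text \<open>\<open>C_on k U f\<close>: \<open>f\<close> is of class $C^k$ on the open set \<open>U\<close>.\<close>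

primrec C_on :: "nat \<Rightarrow> (real \<times> real) set \<Rightarrow> (real \<times> real \<Rightarrow> 'a::real_normed_vector) \<Rightarrow> bool"
  where
    "C_on 0 U f \<longleftrightarrow> continuous_on U f"
  | "C_on (Suc k) U f \<longleftrightarrow> f differentiable_on U \<and> C_on k U (\<partial>\<^sub>x f) \<and> C_on k U (\<partial>\<^sub>y f)"

definition smooth_on :: "(real \<times> real) set \<Rightarrow> (real \<times> real \<Rightarrow> 'a::real_normed_vector) \<Rightarrow> bool"
  where "smooth_on U f \<longleftrightarrow> (\<forall>k. C_on k U f)"

text \<open>The coefficients of the second fundamental form are \<open>r\<^sub>x\<^sub>x \<bullet> n\<close>, \<open>r\<^sub>x\<^sub>y \<bullet> n\<close>,
  \<open>r\<^sub>y\<^sub>y \<bullet> n\<close>; with this sign convention \<open>II = 2 sin \<phi> dx dy\<close> agrees with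
  \<open>r\<^sub>x\<^sub>y = sin \<phi> n\<close>. The Gauss-Weingarten equations and the sine-Gordon equation are
  consequences and are not assumed.\<close>

definition pseudospherical_surface ::
    "(real \<times> real) set \<Rightarrow> (real \<times> real \<Rightarrow> real) \<Rightarrow> (real \<times> real \<Rightarrow> real^3) \<Rightarrow>
     (real \<times> real \<Rightarrow> real^3) \<Rightarrow> bool"
  where "pseudospherical_surface U \<phi> r n \<longleftrightarrow>
    smooth_on U \<phi> \<and> smooth_on U r \<and> smooth_on U n \<and>
    (\<forall>p\<in>U.
      sin (\<phi> p) \<noteq> 0 \<and>
      norm (n p) = 1 \<and> n p \<bullet> \<partial>\<^sub>x r p = 0 \<and> n p \<bullet> \<partial>\<^sub>y r p = 0 \<and>
      \<partial>\<^sub>x r p \<bullet> \<partial>\<^sub>x r p = 1 \<and> \<partial>\<^sub>x r p \<bullet> \<partial>\<^sub>y r p = cos (\<phi> p) \<and> \<partial>\<^sub>y r p \<bullet> \<partial>\<^sub>y r p = 1 \<and>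
      \<partial>\<^sub>x (\<partial>\<^sub>x r) p \<bullet> n p = 0 \<and> \<partial>\<^sub>y (\<partial>\<^sub>x r) p \<bullet> n p = sin (\<phi> p) \<and> \<partial>\<^sub>y (\<partial>\<^sub>y r) p \<bullet> n p = 0)"

definition moutard_solution ::
    "(real \<times> real) set \<Rightarrow> (real \<times> real \<Rightarrow> real) \<Rightarrow> (real \<times> real \<Rightarrow> real) \<Rightarrow> bool"
  where "moutard_solution U \<phi> \<Phi> \<longleftrightarrow>
    smooth_on U \<Phi> \<and> (\<forall>p\<in>U. \<partial>\<^sub>y (\<partial>\<^sub>x \<Phi>) p = \<Phi> p * cos (\<phi> p))"

text \<open>Multivalued operators are relations: \<open>(\<Phi>, \<Psi>)\<close> belongs to the relation if \<open>\<Psi>\<close> is one of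
  the values at \<open>\<Phi>\<close>.\<close>

type_synonym multivalued_op = "((real \<times> real \<Rightarrow> real) \<times> (real \<times> real \<Rightarrow> real)) set"

definition recursion_op :: "(real \<times> real) set \<Rightarrow> (real \<times> real \<Rightarrow> real) \<Rightarrow> multivalued_op"
  where "recursion_op U \<phi> = {(\<Phi>, \<Psi>). moutard_solution U \<phi> \<Phi> \<and>
    (\<exists>Q. smooth_on U Q \<and>
      (\<forall>p\<in>U. \<partial>\<^sub>x Q p = \<partial>\<^sub>x \<Phi> p * \<partial>\<^sub>x \<phi> p \<and> \<partial>\<^sub>y Q p = \<Phi> p * sin (\<phi> p) \<and>
        \<Psi> p = \<partial>\<^sub>x (\<partial>\<^sub>x \<Phi>) p + \<partial>\<^sub>x \<phi> p * Q p))}"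

definition plus_Id :: "multivalued_op \<Rightarrow> multivalued_op"
  where "plus_Id R = {(\<Phi>, \<Psi>). \<exists>\<Theta>. (\<Phi>, \<Theta>) \<in> R \<and> \<Psi> = (\<lambda>p. \<Theta> p + \<Phi> p)}"

definition q1_system ::
    "(real \<times> real) set \<Rightarrow> (real \<times> real \<Rightarrow> real) \<Rightarrow> (real \<times> real \<Rightarrow> real^3) \<Rightarrow>
     (real \<times> real \<Rightarrow> real^3) \<Rightarrow> real^3 \<Rightarrow> (real \<times> real \<Rightarrow> real^3) \<Rightarrow> bool"
  where "q1_system U \<phi> r n c q \<longleftrightarrow> smooth_on U q \<and>
    (\<forall>p\<in>U.
      \<partial>\<^sub>x q p = - (((n p - (\<partial>\<^sub>x \<phi> p / sin (\<phi> p)) *\<^sub>R \<partial>\<^sub>y n p) \<bullet> c) *\<^sub>R (\<partial>\<^sub>y r p /\<^sub>R sin (\<phi> p))) \<and>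
      \<partial>\<^sub>y q p = ((n p - (\<partial>\<^sub>y \<phi> p / sin (\<phi> p)) *\<^sub>R \<partial>\<^sub>x n p) \<bullet> c) *\<^sub>R (\<partial>\<^sub>x r p /\<^sub>R sin (\<phi> p)))"

end

theory Submission
  imports Defs "HOL-Complex_Analysis.Riemann_Mapping"
begin

text \<open>Along the surface, \<open>n\<close>, \<open>a = r\<^sub>x\<close> and \<open>m = n\<^sub>x\<close> form an orthonormal frame with
  \<open>n\<^sub>y = - sin \<phi> a - cos \<phi> m\<close>, \<open>a\<^sub>x = \<phi>\<^sub>x m\<close>, \<open>a\<^sub>y = sin \<phi> n\<close>, \<open>m\<^sub>x = - n - \<phi>\<^sub>x a\<close>,
  \<open>m\<^sub>y = cos \<phi> n\<close>. If \<open>q\<close> solves the system, then \<open>\<Phi> = n \<bullet> q\<close> satisfies the Moutard equation and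
  \<open>Q = r\<^sub>x \<bullet> q + n\<^sub>y \<bullet> c / sin \<phi>\<close> is an admissible potential. Conversely, \<open>\<Phi>\<close> and \<open>Q\<close>
  prescribe the components of \<open>q\<close> in the frame; the only equation that is not immediate,
  \<open>n \<bullet> q\<^sub>y = 0\<close>, is the \<open>y\<close>-derivative of \<open>n \<bullet> c = \<Phi>\<^sub>x\<^sub>x + \<phi>\<^sub>x Q + \<Phi>\<close>. The system is a closed
  vector-valued one-form, hence exact on the simply connected domain \<open>U\<close>.\<close>

section \<open>Calculus of smooth functions on a plane domain\<close>

lemma partials_of_has_derivative:
  assumes "(f has_derivative f') (at p)"
  shows "\<partial>\<^sub>x f p = f' (1, 0)" and "\<partial>\<^sub>y f p = f' (0, 1)"
proof -
  obtain x y where p: "p = (x, y)" by fastforce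
  have x: "((\<lambda>t. f (t, y)) has_derivative (\<lambda>h. f' (h, 0))) (at x)"
    by (rule has_derivative_compose[of "\<lambda>t. (t, y)" "\<lambda>h. (h, 0)", OF _ assms[unfolded p]])
      (auto intro!: derivative_eq_intros)
  have y: "((\<lambda>t. f (x, t)) has_derivative (\<lambda>h. f' (0, h))) (at y)"
    by (rule has_derivative_compose[of "\<lambda>t. (x, t)" "\<lambda>h. (0, h)", OF _ assms[unfolded p]])
      (auto intro!: derivative_eq_intros)
  interpret f': linear f' using assms by (rule has_derivative_linear)
  have *: "f' (h, 0) = h *\<^sub>R f' (1, 0)" "f' (0, h) = h *\<^sub>R f' (0, 1)" for h
    using f'.scaleR[of h "(1, 0)"] f'.scaleR[of h "(0, 1)"] by simp_all
  have "((\<lambda>t. f (t, y)) has_vector_derivative f' (1, 0)) (at x)"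
    "((\<lambda>t. f (x, t)) has_vector_derivative f' (0, 1)) (at y)"
    using x y by (simp_all only: has_vector_derivative_def *[symmetric])
  then show "\<partial>\<^sub>x f p = f' (1, 0)" and "\<partial>\<^sub>y f p = f' (0, 1)"
    by (simp_all add: p partial_x_def partial_y_def vector_derivative_at)
qed

lemma has_derivative_partials:
  assumes "f differentiable (at p)"
  shows "(f has_derivative (\<lambda>h. fst h *\<^sub>R \<partial>\<^sub>x f p + snd h *\<^sub>R \<partial>\<^sub>y f p)) (at p)"
proof -
  obtain f' where f': "(f has_derivative f') (at p)"
    using assms unfolding differentiable_def by blast
  interpret f': linear f' using f' by (rule has_derivative_linear)
  have "f' h = fst h *\<^sub>R \<partial>\<^sub>x f p + snd h *\<^sub>R \<partial>\<^sub>y f p" for h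
    using f'.add[of "fst h *\<^sub>R (1, 0)" "snd h *\<^sub>R (0, 1)"]
      f'.scaleR[of "fst h" "(1, 0)"] f'.scaleR[of "snd h" "(0, 1)"]
    by (simp add: partials_of_has_derivative[OF f'])
  then have "f' = (\<lambda>h. fst h *\<^sub>R \<partial>\<^sub>x f p + snd h *\<^sub>R \<partial>\<^sub>y f p)" by blast
  with f' show ?thesis by simp
qed

text \<open>Stated once for an arbitrary bounded bilinear product, so that multiplication, scaling
  and the inner product all inherit the same rule.\<close>

lemma (in bounded_bilinear) partials:
  assumes "f differentiable (at p)" "g differentiable (at p)"
  shows "\<partial>\<^sub>x (\<lambda>p. prod (f p) (g p)) p = prod (\<partial>\<^sub>x f p) (g p) + prod (f p) (\<partial>\<^sub>x g p)"
    and "\<partial>\<^sub>y (\<lambda>p. prod (f p) (g p)) p = prod (\<partial>\<^sub>y f p) (g p) + prod (f p) (\<partial>\<^sub>y g p)"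
  using partials_of_has_derivative[OF FDERIV[OF assms[THEN has_derivative_partials]]]
  by (simp_all add: add_left add_right scaleR_left scaleR_right zero_left zero_right add.commute)

lemma partials_chain:
  fixes f :: "real \<times> real \<Rightarrow> real"
  assumes "f differentiable (at p)" "(g has_field_derivative g') (at (f p))"
  shows "\<partial>\<^sub>x (\<lambda>p. g (f p)) p = g' * \<partial>\<^sub>x f p" and "\<partial>\<^sub>y (\<lambda>p. g (f p)) p = g' * \<partial>\<^sub>y f p"
  using partials_of_has_derivative[OF has_derivative_compose[OF has_derivative_partials[OF assms(1)],
        OF assms(2)[unfolded has_field_derivative_def]]]
  by simp_all

lemma partials_const [simp]: "\<partial>\<^sub>x (\<lambda>p. c) = (\<lambda>p. 0)" "\<partial>\<^sub>y (\<lambda>p. c) = (\<lambda>p. 0)"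
  by (rule ext, rule partials_of_has_derivative[OF has_derivative_const])+

lemma partials_add_at:
  assumes "f differentiable (at p)" "g differentiable (at p)"
  shows "\<partial>\<^sub>x (\<lambda>p. f p + g p) p = \<partial>\<^sub>x f p + \<partial>\<^sub>x g p" "\<partial>\<^sub>y (\<lambda>p. f p + g p) p = \<partial>\<^sub>y f p + \<partial>\<^sub>y g p"
  using partials_of_has_derivative[OF has_derivative_add[OF assms[THEN has_derivative_partials]]]
  by simp_all

locale plane_domain =
  fixes U :: "(real \<times> real) set"
  assumes open_U: "open U"
begin

text \<open>Since \<open>U\<close> is open, agreement on \<open>U\<close> gives agreement near
  \<open>p\<close> along both coordinate lines, which is all that the partial derivatives see.
  Identities known only on \<open>U\<close> can thus be differentiated.\<close>

lemma
  assumes "\<And>p. p \<in> U \<Longrightarrow> f p = g p" "p \<in> U"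
  shows partial_x_cong: "\<partial>\<^sub>x f p = \<partial>\<^sub>x g p" and partial_y_cong: "\<partial>\<^sub>y f p = \<partial>\<^sub>y g p"
proof -
  obtain x y where p: "p = (x, y)" by fastforce
  have "open ((\<lambda>t. (t, y)) -` U)" "open ((\<lambda>t. (x, t)) -` U)"
    by (auto intro!: continuous_open_vimage continuous_intros open_U)
  then have "eventually (\<lambda>t. (t, y) \<in> U) (nhds x)" "eventually (\<lambda>t. (x, t) \<in> U) (nhds y)"
    using assms(2) unfolding p eventually_nhds by (metis vimage_eq)+
  then have "eventually (\<lambda>t. f (t, y) = g (t, y)) (nhds x)" "eventually (\<lambda>t. f (x, t) = g (x, t)) (nhds y)"
    by (auto elim!: eventually_mono simp: assms(1))
  then show "\<partial>\<^sub>x f p = \<partial>\<^sub>x g p" "\<partial>\<^sub>y f p = \<partial>\<^sub>y g p"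
    by (auto simp: p partial_x_def partial_y_def intro!: vector_derivative_cong_eq)
qed

section \<open>The classes C^k: locality and closure under algebraic operations\<close>

lemma C_on_cong: "(\<And>p. p \<in> U \<Longrightarrow> f p = g p) \<Longrightarrow> C_on k U f \<Longrightarrow> C_on k U g"
proof (induction k arbitrary: f g)
  case 0
  then show ?case by (simp cong: continuous_on_cong)
next
  case (Suc k)
  have "g differentiable_on U"
    using Suc.prems by (auto simp: differentiable_on_def intro: differentiable_transform_within[OF _ zero_less_one])
  moreover have "C_on k U (\<partial>\<^sub>x g)" "C_on k U (\<partial>\<^sub>y g)"
    using Suc.IH[of "\<partial>\<^sub>x f" "\<partial>\<^sub>x g"] Suc.IH[of "\<partial>\<^sub>y f" "\<partial>\<^sub>y g"] Suc.prems
      partial_x_cong[of f g] partial_y_cong[of f g] by auto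
  ultimately show ?case by simp
qed

lemma C_on_SucD: "C_on (Suc k) U f \<Longrightarrow> C_on k U f"
proof (induction k arbitrary: f)
  case 0
  then show ?case using differentiable_imp_continuous_on[of f U] by simp
next
  case (Suc k)
  then show ?case by (metis C_on.simps(2))
qed

lemma smooth_on_cong: "(\<And>p. p \<in> U \<Longrightarrow> f p = g p) \<Longrightarrow> smooth_on U f \<longleftrightarrow> smooth_on U g"
  unfolding smooth_on_def by (metis C_on_cong)

text \<open>Removes the index \<open>k\<close> from later arguments; backwards, class C^k of
  \<open>f\<close> comes from class C^(k+1) by \<open>C_on_SucD\<close>.\<close>

lemma smooth_on_iff:
  "smooth_on U f \<longleftrightarrow> f differentiable_on U \<and> smooth_on U (\<partial>\<^sub>x f) \<and> smooth_on U (\<partial>\<^sub>y f)"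
  unfolding smooth_on_def by (metis C_on.simps(2) C_on_SucD)

lemma differentiable_at_U: "f differentiable_on U \<Longrightarrow> p \<in> U \<Longrightarrow> f differentiable (at p)"
  using open_U by (metis at_within_open differentiable_on_def)

lemma smooth_on_differentiable: "smooth_on U f \<Longrightarrow> p \<in> U \<Longrightarrow> f differentiable (at p)"
  using smooth_on_iff differentiable_at_U by blast

lemma smooth_on_partials [simp]:
  assumes "smooth_on U f"
  shows "smooth_on U (\<partial>\<^sub>x f)" "smooth_on U (\<partial>\<^sub>y f)"
  using assms smooth_on_iff by blast+

lemma smooth_on_continuous: "smooth_on U f \<Longrightarrow> continuous_on U f"
  unfolding smooth_on_def by (metis C_on.simps(1))

text \<open>Allows the partial derivatives to be replaced by formulas valid only on
  \<open>U\<close>, which is what the differentiation rules supply.\<close>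

lemma C_on_SucI:
  assumes "f differentiable_on U" "C_on k U f\<^sub>x" "C_on k U f\<^sub>y"
    and "\<And>p. p \<in> U \<Longrightarrow> \<partial>\<^sub>x f p = f\<^sub>x p" "\<And>p. p \<in> U \<Longrightarrow> \<partial>\<^sub>y f p = f\<^sub>y p"
  shows "C_on (Suc k) U f"
  using assms(1) C_on_cong[OF _ assms(2), of "\<partial>\<^sub>x f"] C_on_cong[OF _ assms(3), of "\<partial>\<^sub>y f"] assms(4,5)
  by simp

lemma C_on_const [simp]: "C_on k U (\<lambda>p. c)"
  by (induction k arbitrary: c) simp_all

lemma C_on_add: "C_on k U f \<Longrightarrow> C_on k U g \<Longrightarrow> C_on k U (\<lambda>p. f p + g p)"
proof (induction k arbitrary: f g)
  case 0
  then show ?case by (simp add: continuous_on_add)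
next
  case (Suc k)
  show ?case
  proof (rule C_on_SucI)
    show "C_on k U (\<lambda>p. \<partial>\<^sub>x f p + \<partial>\<^sub>x g p)" "C_on k U (\<lambda>p. \<partial>\<^sub>y f p + \<partial>\<^sub>y g p)"
      using Suc by simp_all
    show "(\<lambda>p. f p + g p) differentiable_on U"
      using Suc.prems by (simp add: differentiable_on_add)
  qed (use Suc.prems in \<open>simp_all add: partials_add_at differentiable_at_U\<close>)
qed

text \<open>The product rule turns each partial derivative into a sum of products of C^k factors;
  \<open>C_on_SucD\<close> covers the undifferentiated ones.\<close>

lemma C_on_bilinear:
  assumes "bounded_bilinear B"
  shows "C_on k U f \<Longrightarrow> C_on k U g \<Longrightarrow> C_on k U (\<lambda>p. B (f p) (g p))"
proof (induction k arbitrary: f g)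
  case 0
  then show ?case using bounded_bilinear.continuous_on[OF assms] by simp
next
  case (Suc k)
  note f = Suc.prems(1)[THEN C_on_SucD] and g = Suc.prems(2)[THEN C_on_SucD]
  show ?case
  proof (rule C_on_SucI)
    show "C_on k U (\<lambda>p. B (\<partial>\<^sub>x f p) (g p) + B (f p) (\<partial>\<^sub>x g p))"
      "C_on k U (\<lambda>p. B (\<partial>\<^sub>y f p) (g p) + B (f p) (\<partial>\<^sub>y g p))"
      using Suc.prems f g by (simp_all add: C_on_add Suc.IH)
    show "(\<lambda>p. B (f p) (g p)) differentiable_on U"
      unfolding differentiable_on_def
    proof
      fix p assume "p \<in> U"
      then have "f differentiable (at p within U)" "g differentiable (at p within U)"
        using Suc.prems by (simp_all add: differentiable_on_def)
      then show "(\<lambda>p. B (f p) (g p)) differentiable (at p within U)"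
        unfolding differentiable_def using bounded_bilinear.FDERIV[OF assms] by blast
    qed
  qed (use Suc.prems in \<open>simp_all add: bounded_bilinear.partials[OF assms] differentiable_at_U\<close>)
qed

text \<open>One joint induction, because each of the two functions is, up to sign, the derivative of
  the other.\<close>

lemma C_on_sin_cos:
  fixes f :: "real \<times> real \<Rightarrow> real"
  shows "C_on k U f \<Longrightarrow> C_on k U (\<lambda>p. sin (f p)) \<and> C_on k U (\<lambda>p. cos (f p))"
proof (induction k)
  case 0
  then show ?case by (simp add: continuous_on_sin continuous_on_cos)
next
  case (Suc k)
  note f = differentiable_at_U[of f] and mult = C_on_bilinear[OF bounded_bilinear_mult]
  have IH: "C_on k U (\<lambda>p. sin (f p))" "C_on k U (\<lambda>p. cos (f p))"
    using Suc C_on_SucD by blast+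
  have neg_sin: "C_on k U (\<lambda>p. - sin (f p))"
    using mult[OF C_on_const IH(1), of "-1"] by simp
  have "(\<lambda>p. sin (f p)) differentiable_on U" "(\<lambda>p. cos (f p)) differentiable_on U"
    using Suc.prems has_derivative_sin has_derivative_cos
    unfolding C_on.simps differentiable_on_def differentiable_def by blast+
  moreover have "C_on k U (\<lambda>p. cos (f p) * \<partial>\<^sub>x f p)" "C_on k U (\<lambda>p. cos (f p) * \<partial>\<^sub>y f p)"
    "C_on k U (\<lambda>p. - sin (f p) * \<partial>\<^sub>x f p)" "C_on k U (\<lambda>p. - sin (f p) * \<partial>\<^sub>y f p)"
    using Suc.prems by (simp_all only: C_on.simps mult[OF IH(2)] mult[OF neg_sin])
  ultimately show ?case
    using Suc.prems
    by (intro conjI; elim C_on_SucI)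
      (simp_all only: C_on.simps partials_chain[OF f DERIV_sin] partials_chain[OF f DERIV_cos])
qed

text \<open>The derivative of 1/f is a product of a derivative of f with two copies of 1/f and a
  sign, so closure under products carries the induction.\<close>

lemma C_on_inverse:
  fixes f :: "real \<times> real \<Rightarrow> real"
  assumes "\<And>p. p \<in> U \<Longrightarrow> f p \<noteq> 0"
  shows "C_on k U f \<Longrightarrow> C_on k U (\<lambda>p. inverse (f p))"
proof (induction k)
  case 0
  with assms show ?case by (simp add: continuous_on_inverse)
next
  case (Suc k)
  note f = differentiable_at_U[of f] and mult = C_on_bilinear[OF bounded_bilinear_mult]
  have IH: "C_on k U (\<lambda>p. inverse (f p))"
    using Suc C_on_SucD by blast
  let ?d = "\<lambda>p. - 1 * (inverse (f p) * inverse (f p))"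
  have d: "C_on k U ?d"
    by (rule mult[OF C_on_const mult[OF IH IH]])
  have "(\<lambda>p. inverse (f p)) differentiable_on U"
    using Suc.prems assms by (simp add: differentiable_on_def differentiable_inverse)
  moreover have "C_on k U (\<lambda>p. ?d p * \<partial>\<^sub>x f p)" "C_on k U (\<lambda>p. ?d p * \<partial>\<^sub>y f p)"
    using Suc.prems by (simp_all only: C_on.simps mult[OF d])
  ultimately show ?case
    by (rule C_on_SucI) (use Suc.prems in
      \<open>simp_all add: partials_chain[OF f DERIV_inverse[OF assms]] numeral_2_eq_2\<close>)
qed

lemma smooth_on_const [simp]: "smooth_on U (\<lambda>p. c)"
  by (simp add: smooth_on_def)

lemma smooth_on_add [simp]:
  "smooth_on U f \<Longrightarrow> smooth_on U g \<Longrightarrow> smooth_on U (\<lambda>p. f p + g p)"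
  by (simp add: smooth_on_def C_on_add)

lemma smooth_on_scaleR [simp]:
  "smooth_on U f \<Longrightarrow> smooth_on U g \<Longrightarrow> smooth_on U (\<lambda>p. f p *\<^sub>R g p)"
  by (simp add: smooth_on_def C_on_bilinear[OF bounded_bilinear_scaleR])

lemma smooth_on_mult [simp]:
  fixes f g :: "real \<times> real \<Rightarrow> real"
  shows "smooth_on U f \<Longrightarrow> smooth_on U g \<Longrightarrow> smooth_on U (\<lambda>p. f p * g p)"
  by (simp add: smooth_on_def C_on_bilinear[OF bounded_bilinear_mult])

lemma smooth_on_inner [simp]:
  "smooth_on U f \<Longrightarrow> smooth_on U g \<Longrightarrow> smooth_on U (\<lambda>p. f p \<bullet> g p)"
  by (simp add: smooth_on_def C_on_bilinear[OF bounded_bilinear_inner])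

lemma smooth_on_minus [simp]: "smooth_on U f \<Longrightarrow> smooth_on U (\<lambda>p. - f p)"
  using smooth_on_scaleR[of "\<lambda>p. -1" f] by simp

lemma smooth_on_diff [simp]:
  "smooth_on U f \<Longrightarrow> smooth_on U g \<Longrightarrow> smooth_on U (\<lambda>p. f p - g p)"
  using smooth_on_add[of f "\<lambda>p. - g p"] by simp

lemma smooth_on_sin_cos [simp]:
  fixes f :: "real \<times> real \<Rightarrow> real"
  assumes "smooth_on U f"
  shows "smooth_on U (\<lambda>p. sin (f p))" "smooth_on U (\<lambda>p. cos (f p))"
  using assms C_on_sin_cos by (auto simp: smooth_on_def)

lemma smooth_on_divide [simp]:
  fixes f g :: "real \<times> real \<Rightarrow> real"
  assumes "smooth_on U f" "smooth_on U g" "\<And>p. p \<in> U \<Longrightarrow> g p \<noteq> 0"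
  shows "smooth_on U (\<lambda>p. f p / g p)"
  using assms smooth_on_mult[of f "\<lambda>p. inverse (g p)"] C_on_inverse[of g]
  by (auto simp: smooth_on_def field_class.field_divide_inverse)

text \<open>Meant for primitives: their derivative is prescribed by smooth coefficients, from which
  they inherit smoothness.\<close>

lemma smooth_onI:
  assumes "\<And>p. p \<in> U \<Longrightarrow> (f has_derivative (\<lambda>h. fst h *\<^sub>R f\<^sub>x p + snd h *\<^sub>R f\<^sub>y p)) (at p)"
    and "smooth_on U f\<^sub>x" "smooth_on U f\<^sub>y"
  shows "smooth_on U f"
proof -
  have "f differentiable_on U"
    using assms(1) by (meson differentiable_at_imp_differentiable_on differentiableI)
  moreover have "\<partial>\<^sub>x f p = f\<^sub>x p" "\<partial>\<^sub>y f p = f\<^sub>y p" if "p \<in> U" for p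
    using partials_of_has_derivative[OF assms(1)[OF that]] by simp_all
  then have "smooth_on U (\<partial>\<^sub>x f)" "smooth_on U (\<partial>\<^sub>y f)"
    using assms(2,3) smooth_on_cong[of "\<partial>\<^sub>x f" f\<^sub>x] smooth_on_cong[of "\<partial>\<^sub>y f" f\<^sub>y] by simp_all
  ultimately show ?thesis
    using smooth_on_iff by blast
qed

section \<open>Differentiation rules for smooth functions\<close>

lemma partials_add [simp]:
  assumes "smooth_on U f" "smooth_on U g" "p \<in> U"
  shows "\<partial>\<^sub>x (\<lambda>p. f p + g p) p = \<partial>\<^sub>x f p + \<partial>\<^sub>x g p" "\<partial>\<^sub>y (\<lambda>p. f p + g p) p = \<partial>\<^sub>y f p + \<partial>\<^sub>y g p"
  using assms by (simp_all add: partials_add_at smooth_on_differentiable)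

lemma partials_scaleR [simp]:
  assumes "smooth_on U f" "smooth_on U g" "p \<in> U"
  shows "\<partial>\<^sub>x (\<lambda>p. f p *\<^sub>R g p) p = \<partial>\<^sub>x f p *\<^sub>R g p + f p *\<^sub>R \<partial>\<^sub>x g p"
    and "\<partial>\<^sub>y (\<lambda>p. f p *\<^sub>R g p) p = \<partial>\<^sub>y f p *\<^sub>R g p + f p *\<^sub>R \<partial>\<^sub>y g p"
  using assms by (simp_all add: bounded_bilinear.partials[OF bounded_bilinear_scaleR] smooth_on_differentiable)

lemma partials_mult [simp]:
  fixes f g :: "real \<times> real \<Rightarrow> real"
  assumes "smooth_on U f" "smooth_on U g" "p \<in> U"
  shows "\<partial>\<^sub>x (\<lambda>p. f p * g p) p = \<partial>\<^sub>x f p * g p + f p * \<partial>\<^sub>x g p"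
    and "\<partial>\<^sub>y (\<lambda>p. f p * g p) p = \<partial>\<^sub>y f p * g p + f p * \<partial>\<^sub>y g p"
  using assms by (simp_all add: bounded_bilinear.partials[OF bounded_bilinear_mult] smooth_on_differentiable)

lemma partials_inner [simp]:
  assumes "smooth_on U f" "smooth_on U g" "p \<in> U"
  shows "\<partial>\<^sub>x (\<lambda>p. f p \<bullet> g p) p = \<partial>\<^sub>x f p \<bullet> g p + f p \<bullet> \<partial>\<^sub>x g p"
    and "\<partial>\<^sub>y (\<lambda>p. f p \<bullet> g p) p = \<partial>\<^sub>y f p \<bullet> g p + f p \<bullet> \<partial>\<^sub>y g p"
  using assms by (simp_all add: bounded_bilinear.partials[OF bounded_bilinear_inner] smooth_on_differentiable)

lemma partials_minus [simp]:
  assumes "smooth_on U f" "p \<in> U"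
  shows "\<partial>\<^sub>x (\<lambda>p. - f p) p = - \<partial>\<^sub>x f p" "\<partial>\<^sub>y (\<lambda>p. - f p) p = - \<partial>\<^sub>y f p"
  using assms partials_scaleR[of "\<lambda>p. -1" f p] by simp_all

lemma partials_diff [simp]:
  assumes "smooth_on U f" "smooth_on U g" "p \<in> U"
  shows "\<partial>\<^sub>x (\<lambda>p. f p - g p) p = \<partial>\<^sub>x f p - \<partial>\<^sub>x g p" "\<partial>\<^sub>y (\<lambda>p. f p - g p) p = \<partial>\<^sub>y f p - \<partial>\<^sub>y g p"
  using assms partials_add[of f "\<lambda>p. - g p" p] by simp_all

lemma partials_sin_cos [simp]:
  fixes f :: "real \<times> real \<Rightarrow> real"
  assumes "smooth_on U f" "p \<in> U"
  shows "\<partial>\<^sub>x (\<lambda>p. sin (f p)) p = cos (f p) * \<partial>\<^sub>x f p" "\<partial>\<^sub>y (\<lambda>p. sin (f p)) p = cos (f p) * \<partial>\<^sub>y f p"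
    "\<partial>\<^sub>x (\<lambda>p. cos (f p)) p = - sin (f p) * \<partial>\<^sub>x f p" "\<partial>\<^sub>y (\<lambda>p. cos (f p)) p = - sin (f p) * \<partial>\<^sub>y f p"
  using partials_chain[OF smooth_on_differentiable[OF assms] DERIV_sin]
    partials_chain[OF smooth_on_differentiable[OF assms] DERIV_cos] by auto

text \<open>Keeping the quotient itself on the right avoids powers of \<open>g\<close> and lets
  named quotients such as \<open>K\<close> and \<open>H\<close> reappear after
  differentiation.\<close>

lemma partials_divide:
  fixes f g :: "real \<times> real \<Rightarrow> real"
  assumes "smooth_on U f" "smooth_on U g" "p \<in> U" "g p \<noteq> 0"
  shows "\<partial>\<^sub>x (\<lambda>p. f p / g p) p = (\<partial>\<^sub>x f p - (f p / g p) * \<partial>\<^sub>x g p) / g p"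
    and "\<partial>\<^sub>y (\<lambda>p. f p / g p) p = (\<partial>\<^sub>y f p - (f p / g p) * \<partial>\<^sub>y g p) / g p"
proof -
  note g = smooth_on_differentiable[OF assms(2,3)]
  have "(\<lambda>p. inverse (g p)) differentiable (at p)"
    using g assms(4) by (rule differentiable_inverse)
  note * = bounded_bilinear.partials[OF bounded_bilinear_mult smooth_on_differentiable[OF assms(1,3)] this]
  show "\<partial>\<^sub>x (\<lambda>p. f p / g p) p = (\<partial>\<^sub>x f p - (f p / g p) * \<partial>\<^sub>x g p) / g p"
    and "\<partial>\<^sub>y (\<lambda>p. f p / g p) p = (\<partial>\<^sub>y f p - (f p / g p) * \<partial>\<^sub>y g p) / g p"
    unfolding divide_inverse * partials_chain[OF g DERIV_inverse[OF assms(4)]]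
    by (simp_all add: algebra_simps numeral_2_eq_2)
qed

section \<open>Symmetry of the mixed partial derivatives\<close>

lemma has_vector_derivative_partials:
  assumes "smooth_on U f" "(x, y) \<in> U"
  shows "((\<lambda>t. f (t, y)) has_vector_derivative \<partial>\<^sub>x f (x, y)) (at x)"
    and "((\<lambda>t. f (x, t)) has_vector_derivative \<partial>\<^sub>y f (x, y)) (at y)"
proof -
  note f = has_derivative_partials[OF smooth_on_differentiable[OF assms]]
  have "((\<lambda>t. f (t, y)) has_derivative (\<lambda>h. fst (h, 0::real) *\<^sub>R \<partial>\<^sub>x f (x, y) + snd (h, 0::real) *\<^sub>R \<partial>\<^sub>y f (x, y))) (at x)"
    by (rule has_derivative_compose[of "\<lambda>t. (t, y)", OF _ f]) (auto intro!: derivative_eq_intros)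
  then show "((\<lambda>t. f (t, y)) has_vector_derivative \<partial>\<^sub>x f (x, y)) (at x)"
    by (simp add: has_vector_derivative_def)
  have "((\<lambda>t. f (x, t)) has_derivative (\<lambda>h. fst (0::real, h) *\<^sub>R \<partial>\<^sub>x f (x, y) + snd (0::real, h) *\<^sub>R \<partial>\<^sub>y f (x, y))) (at y)"
    by (rule has_derivative_compose[of "\<lambda>t. (x, t)", OF _ f]) (auto intro!: derivative_eq_intros)
  then show "((\<lambda>t. f (x, t)) has_vector_derivative \<partial>\<^sub>y f (x, y)) (at y)"
    by (simp add: has_vector_derivative_def)
qed

text \<open>Schwarz's theorem. An increment of \<open>f\<close> in x is the integral of
  \<open>\<partial>\<^sub>x f\<close>; differentiating under the integral sign in y, and then in the
  upper limit, yields both mixed derivatives.\<close>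

lemma mixed_partials:
  fixes f :: "real \<times> real \<Rightarrow> 'a::banach"
  assumes f: "smooth_on U f" and p: "p \<in> U"
  shows "\<partial>\<^sub>y (\<partial>\<^sub>x f) p = \<partial>\<^sub>x (\<partial>\<^sub>y f) p"
proof -
  obtain x0 y0 where [simp]: "p = (x0, y0)" by fastforce
  obtain I J where IJ: "open I" "open J" "p \<in> I \<times> J" "I \<times> J \<subseteq> U"
    by (rule open_prod_elim[OF open_U p])
  then have "x0 \<in> I" "y0 \<in> J" by auto
  with IJ obtain d e where "0 < d" "0 < e" "cball x0 d \<subseteq> I" "cball y0 e \<subseteq> J"
    by (meson open_contains_cball_eq)
  \<comment> \<open>A closed rectangle inside \<open>U\<close> with \<open>p\<close> in its
    interior; all integrals below stay in it.\<close>
  define l u v w where "l = x0 - d" and "u = x0 + d" and "v = y0 - e" and "w = y0 + e"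
  have lu: "l < x0" "x0 < u" "v < y0" "y0 < w"
    using \<open>0 < d\<close> \<open>0 < e\<close> by (simp_all add: l_def u_def v_def w_def)
  have "{l..u} \<times> {v..w} \<subseteq> U"
    using \<open>cball x0 d \<subseteq> I\<close> \<open>cball y0 e \<subseteq> J\<close> IJ(4)
    unfolding cball_eq_atLeastAtMost l_def u_def v_def w_def by blast
  then have sub: "\<And>x y. \<lbrakk>l \<le> x; x \<le> u; v \<le> y; y \<le> w\<rbrakk> \<Longrightarrow> (x, y) \<in> U"
    by auto
  note derivs = has_vector_derivative_partials[OF _ sub, THEN has_vector_derivative_at_within]
  have cont: "continuous_on U g \<Longrightarrow> continuous_on {l..u} (\<lambda>t. g (t, y))" if "v \<le> y" "y \<le> w" for g y
    by (rule continuous_on_compose2[of U g]) (use that in \<open>auto intro!: continuous_intros sub\<close>)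
  have diff: "f (x, y) - f (l, y) = integral {l..x} (\<lambda>t. \<partial>\<^sub>x f (t, y))"
    if "l \<le> x" "x \<le> u" "v \<le> y" "y \<le> w" for x y
    by (rule integral_unique[symmetric], rule fundamental_theorem_of_calculus)
      (use that in \<open>auto intro!: derivs(1) f\<close>)
  have "\<partial>\<^sub>y f (x, y0) - \<partial>\<^sub>y f (l, y0) = integral {l..x} (\<lambda>t. \<partial>\<^sub>y (\<partial>\<^sub>x f) (t, y0))"
    if x: "l \<le> x" "x \<le> u" for x
  proof -
    have "((\<lambda>y. integral (cbox l x) (\<lambda>t. \<partial>\<^sub>x f (t, y))) has_vector_derivative
        integral (cbox l x) (\<lambda>t. \<partial>\<^sub>y (\<partial>\<^sub>x f) (t, y0))) (at y0 within {v..w})"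
    proof (rule leibniz_rule_vector_derivative)
      show "(\<lambda>t. \<partial>\<^sub>x f (t, y)) integrable_on cbox l x" if "y \<in> {v..w}" for y
        using that x f smooth_on_continuous[of "\<partial>\<^sub>x f"]
        by (auto intro!: integrable_continuous_real continuous_on_subset[OF cont])
      have "continuous_on U (\<partial>\<^sub>y (\<partial>\<^sub>x f))"
        using f by (simp add: smooth_on_continuous)
      then show "continuous_on ({v..w} \<times> cbox l x) (\<lambda>(y, t). \<partial>\<^sub>y (\<partial>\<^sub>x f) (t, y))"
        unfolding split_beta
        by (rule continuous_on_compose2) (use x in \<open>auto intro!: continuous_intros sub\<close>)
    qed (use x lu f in \<open>auto intro!: derivs(2)\<close>)
    moreover have "((\<lambda>y. f (x, y) - f (l, y)) has_vector_derivative \<partial>\<^sub>y f (x, y0) - \<partial>\<^sub>y f (l, y0))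
        (at y0 within {v..w})"
      using x lu f by (intro has_vector_derivative_diff derivs(2)) auto
    then have "((\<lambda>y. integral (cbox l x) (\<lambda>t. \<partial>\<^sub>x f (t, y))) has_vector_derivative
        \<partial>\<^sub>y f (x, y0) - \<partial>\<^sub>y f (l, y0)) (at y0 within {v..w})"
      by (rule has_vector_derivative_transform[rotated -1]) (use x lu in \<open>auto simp: diff\<close>)
    ultimately show ?thesis
      using lu vector_derivative_unique_within_closed_interval[of v w y0] by auto
  qed
  moreover have "((\<lambda>x. integral {l..x} (\<lambda>t. \<partial>\<^sub>y (\<partial>\<^sub>x f) (t, y0))) has_vector_derivative
      \<partial>\<^sub>y (\<partial>\<^sub>x f) (x0, y0)) (at x0 within {l..u})"
    using lu f by (intro integral_has_vector_derivative cont) (auto intro: smooth_on_continuous)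
  ultimately have "((\<lambda>x. \<partial>\<^sub>y f (x, y0) - \<partial>\<^sub>y f (l, y0)) has_vector_derivative
      \<partial>\<^sub>y (\<partial>\<^sub>x f) (x0, y0)) (at x0 within {l..u})"
    by (elim has_vector_derivative_transform[rotated -1]) (use lu in auto)
  \<comment> \<open>The subtracted value at \<open>l\<close> is constant in x, so the same function
    also has the other mixed derivative; uniqueness of the derivative concludes.\<close>
  moreover have "((\<lambda>x. \<partial>\<^sub>y f (x, y0) - \<partial>\<^sub>y f (l, y0)) has_vector_derivative
      \<partial>\<^sub>x (\<partial>\<^sub>y f) (x0, y0) - 0) (at x0 within {l..u})"
    using lu f by (intro has_vector_derivative_diff derivs(1) has_vector_derivative_const) auto
  ultimately show ?thesis
    using lu vector_derivative_unique_within_closed_interval[of l u x0] by auto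
qed

end

section \<open>Closed one-forms on simply connected plane domains\<close>

text \<open>The Poincare lemma with radial primitive: F(z) is the integral of
  \<open>\<omega> (t *\<^sub>R z) z\<close> over t from 0 to 1. Convexity and
  \<open>0 \<in> S\<close> keep the segment from 0 to z in \<open>S\<close>.\<close>

lemma closed_form_has_primitive_convex:
  fixes \<omega> :: "'a::banach \<Rightarrow> 'a \<Rightarrow>\<^sub>L 'b::banach"
  assumes S: "open S" "convex S" "0 \<in> S"
    and \<omega>: "\<And>z. z \<in> S \<Longrightarrow> (\<omega> has_derivative D z) (at z)"
    and sym: "\<And>z h k. z \<in> S \<Longrightarrow> D z h k = D z k h"
    and cont: "continuous_on (S \<times> UNIV) (\<lambda>(z, h). D z h)"
  shows "\<exists>F. \<forall>z\<in>S. (F has_derivative \<omega> z) (at z)"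
proof (intro exI ballI)
  fix z assume z: "z \<in> S"
  \<comment> \<open>The derivative of the integrand in z, rewritten by symmetry of \<open>D\<close>;
    it is also the derivative of \<open>t *\<^sub>R \<omega> (t *\<^sub>R z)\<close> in t.\<close>
  define E where "E z t = \<omega> (t *\<^sub>R z) + t *\<^sub>R D (t *\<^sub>R z) z" for z t
  have star: "t *\<^sub>R z \<in> S" if "z \<in> S" "t \<in> cbox 0 1" for z t
    using S(2,3) that convexD[of S z 0 t "1 - t"] by simp
  have cont_\<omega>: "continuous_on S \<omega>"
    using \<omega> has_derivative_continuous continuous_at_imp_continuous_on by blast
  have "((\<lambda>z. integral (cbox 0 1) (\<lambda>t. \<omega> (t *\<^sub>R z) z)) has_derivative integral (cbox 0 1) (E z))
      (at z within S)"
  proof (rule leibniz_rule)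
    fix z :: 'a and t :: real assume zt: "z \<in> S" "t \<in> cbox 0 1"
    have D: "((\<lambda>z. \<omega> (t *\<^sub>R z)) has_derivative (\<lambda>h. D (t *\<^sub>R z) (t *\<^sub>R h))) (at z)"
      by (rule has_derivative_compose[of "\<lambda>z. t *\<^sub>R z", OF _ \<omega>[OF star[OF zt]]]) (auto intro!: derivative_eq_intros)
    interpret D: linear "D (t *\<^sub>R z)"
      using \<omega>[OF star[OF zt]] by (rule has_derivative_linear)
    have "((\<lambda>z. \<omega> (t *\<^sub>R z) z) has_derivative (\<lambda>h. \<omega> (t *\<^sub>R z) h + D (t *\<^sub>R z) (t *\<^sub>R h) z)) (at z)"
      by (rule blinfun.FDERIV[OF D has_derivative_ident])
    moreover have "D (t *\<^sub>R z) (t *\<^sub>R h) z = t *\<^sub>R D (t *\<^sub>R z) z h" for h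
      using sym[OF star[OF zt], of h z] by (simp add: D.scaleR blinfun.scaleR_left)
    ultimately show "((\<lambda>z. \<omega> (t *\<^sub>R z) z) has_derivative E z t) (at z within S)"
      by (simp add: E_def plus_blinfun.rep_eq scaleR_blinfun.rep_eq has_derivative_at_withinI)
  next
    fix z assume "z \<in> S"
    then show "(\<lambda>t. \<omega> (t *\<^sub>R z) z) integrable_on cbox 0 1"
      by (intro integrable_continuous continuous_intros continuous_on_compose2[OF cont_\<omega>])
        (auto intro!: star)
  next
    have "continuous_on (S \<times> cbox 0 1) (\<lambda>x. case (snd x *\<^sub>R fst x, fst x) of (z, h) \<Rightarrow> D z h)"
      by (rule continuous_on_compose2[OF cont]) (auto intro!: continuous_intros star)
    moreover have "continuous_on (S \<times> cbox 0 1) (\<lambda>x. \<omega> (snd x *\<^sub>R fst x))"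
      by (rule continuous_on_compose2[OF cont_\<omega>]) (auto intro!: continuous_intros star)
    ultimately show "continuous_on (S \<times> cbox 0 1) (\<lambda>(z, t). E z t)"
      unfolding E_def split_beta by (auto intro!: continuous_intros)
  qed (use z S in auto)
  \<comment> \<open>As a t-derivative, \<open>E z\<close> integrates to the difference of the
    endpoint values, which is \<open>\<omega> z\<close>.\<close>
  moreover have "(E z has_integral 1 *\<^sub>R \<omega> (1 *\<^sub>R z) - 0 *\<^sub>R \<omega> (0 *\<^sub>R z)) {0..1}"
  proof (rule fundamental_theorem_of_calculus)
    fix t :: real assume t: "t \<in> {0..1}"
    then have tz: "t *\<^sub>R z \<in> S" using star z by simp
    interpret D: linear "D (t *\<^sub>R z)"
      using \<omega>[OF tz] by (rule has_derivative_linear)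
    have "((\<lambda>t. \<omega> (t *\<^sub>R z)) has_derivative (\<lambda>h. D (t *\<^sub>R z) (h *\<^sub>R z))) (at t)"
      by (rule has_derivative_compose[of "\<lambda>t. t *\<^sub>R z", OF _ \<omega>[OF tz]]) (auto intro!: derivative_eq_intros)
    then have "((\<lambda>t. \<omega> (t *\<^sub>R z)) has_vector_derivative D (t *\<^sub>R z) z) (at t within {0..1})"
      by (simp add: has_vector_derivative_def D.scaleR has_derivative_at_withinI)
    from has_vector_derivative_scaleR[OF DERIV_ident this]
    show "((\<lambda>t. t *\<^sub>R \<omega> (t *\<^sub>R z)) has_vector_derivative E z t) (at t within {0..1})"
      by (simp add: E_def add.commute)
  qed simp
  then have "integral (cbox 0 1) (E z) = \<omega> z"
    by (simp add: integral_unique)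
  ultimately show "((\<lambda>z. integral (cbox 0 1) (\<lambda>t. \<omega> (t *\<^sub>R z) z)) has_derivative \<omega> z) (at z)"
    using at_within_open[OF z S(1)] by simp
qed

text \<open>The Riemann mapping theorem supplies the unit disc for proper domains; the whole plane
  is already convex and is handled by the identity.\<close>

lemma simply_connected_biholomorphic_convex:
  assumes "open V" "simply_connected V" "V \<noteq> {}"
  obtains S k g where "open S" "convex S" "0 \<in> S" "k holomorphic_on S" "g holomorphic_on V"
    "\<And>z. z \<in> S \<Longrightarrow> k z \<in> V" "\<And>w. w \<in> V \<Longrightarrow> g w \<in> S" "\<And>w. w \<in> V \<Longrightarrow> k (g w) = w"
proof (cases "V = UNIV")
  case True
  then show ?thesis
    by (intro that[of UNIV id id]) (auto simp: id_def)
next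
  case False
  then obtain f g where "f holomorphic_on V" "g holomorphic_on ball 0 1"
    "\<And>z. z \<in> V \<Longrightarrow> f z \<in> ball 0 1 \<and> g (f z) = z" "\<And>z. z \<in> ball 0 1 \<Longrightarrow> g z \<in> V"
    using Riemann_mapping_theorem[of V] assms by blast
  then show ?thesis
    by (intro that[of "ball 0 1" g f]) auto
qed

text \<open>The form a dx + b dy as an element of a space of bounded linear maps, so that it can be
  differentiated in its coefficients and composed with \<open>o\<^sub>L\<close> for
  pullbacks.\<close>

definition one_form :: "'b::real_normed_vector \<Rightarrow> 'b \<Rightarrow> (real \<times> real) \<Rightarrow>\<^sub>L 'b"
  where "one_form a b = (blinfun_scaleR_left a o\<^sub>L fst_blinfun) + (blinfun_scaleR_left b o\<^sub>L snd_blinfun)"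

lemma one_form_apply [simp]: "one_form a b h = fst h *\<^sub>R a + snd h *\<^sub>R b"
  by (simp add: one_form_def blinfun.add_left)

lemma has_derivative_one_form [derivative_intros]:
  assumes "(f has_derivative f') F" "(g has_derivative g') F"
  shows "((\<lambda>x. one_form (f x) (g x)) has_derivative (\<lambda>h. one_form (f' h) (g' h))) F"
  unfolding one_form_def
  by (intro has_derivative_add assms bounded_linear.has_derivative[OF bounded_linear_compose[OF
        bounded_bilinear.bounded_linear_left[OF bounded_bilinear_blinfun_compose]
        bounded_linear_blinfun_scaleR_left]])

lemma continuous_on_one_form [continuous_intros]:
  assumes "continuous_on S f" "continuous_on S g"
  shows "continuous_on S (\<lambda>x. one_form (f x) (g x))"
  unfolding one_form_def using assms by (auto intro!: continuous_intros)

context plane_domain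
begin

text \<open>The form is pulled back along a Riemann map to a disc or the whole plane, where the
  radial primitive is available.\<close>

lemma closed_form_has_primitive:
  fixes A B :: "real \<times> real \<Rightarrow> 'b::banach"
  assumes "simply_connected U" and smooth: "smooth_on U A" "smooth_on U B"
    and closed: "\<And>p. p \<in> U \<Longrightarrow> \<partial>\<^sub>y A p = \<partial>\<^sub>x B p"
  shows "\<exists>F. \<forall>p\<in>U. (F has_derivative (\<lambda>h. fst h *\<^sub>R A p + snd h *\<^sub>R B p)) (at p)"
proof (cases "U = {}")
  case False
  define T :: "complex \<Rightarrow> real \<times> real" where "T = (\<lambda>z. (Re z, Im z))"
  define T' where "T' = (\<lambda>p. Complex (fst p) (snd p))"
  have [simp]: "T (T' p) = p" "T' (T z) = z" for p z
    by (simp_all add: T_def T'_def)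
  have T: "bounded_linear T"
    unfolding T_def by (intro bounded_linear_Pair bounded_linear_Re bounded_linear_Im)
  have T': "bounded_linear T'"
    unfolding T'_def Complex_eq
    by (intro bounded_linear_add bounded_linear_const_mult
        bounded_linear_compose[OF bounded_linear_of_real bounded_linear_fst]
        bounded_linear_compose[OF bounded_linear_of_real bounded_linear_snd])
  define V where "V = T' ` U"
  have V_eq: "V = T -` U"
    unfolding V_def by (auto simp: image_iff) (metis \<open>\<And>z. T' (T z) = z\<close>)
  have cont: "continuous_on S T" "continuous_on S' T'" for S S'
    using T T' by (auto simp: linear_continuous_on)
  have "open V"
    unfolding V_eq using open_U cont by (metis open_vimage)
  moreover have "U homeomorphic V"
    unfolding homeomorphic_def homeomorphism_def V_def
    using cont by (intro exI[of _ T'] exI[of _ T]) (auto simp: image_image)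
  then have "simply_connected V"
    using assms(1) homeomorphic_simply_connected_eq by blast
  ultimately obtain S k g where S: "open S" "convex S" "0 \<in> S"
    and k: "k holomorphic_on S" and g: "g holomorphic_on V"
    and kS: "\<And>z. z \<in> S \<Longrightarrow> k z \<in> V" and gV: "\<And>w. w \<in> V \<Longrightarrow> g w \<in> S"
    and kg: "\<And>w. w \<in> V \<Longrightarrow> k (g w) = w"
    using simply_connected_biholomorphic_convex False V_def by (metis image_is_empty)
  have k': "deriv k holomorphic_on S"
    using k S(1) by (rule holomorphic_deriv)
  have TkS: "T (k z) \<in> U" if "z \<in> S" for z
    using kS[OF that] by (simp add: V_eq)
  \<comment> \<open>The real differential of \<open>T\<close> composed with a holomorphic map of
    complex derivative \<open>w\<close>.\<close>
  define L where "L w = Blinfun T o\<^sub>L blinfun_mult_right w" for w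
  have L_apply [simp]: "L w h = T (w * h)" for w h
    by (simp add: L_def bounded_linear_Blinfun_apply[OF T] blinfun_mult_right.rep_eq)
  \<comment> \<open>The pullback of A dx + B dy along \<open>T\<close> after
    \<open>k\<close>.\<close>
  define \<omega> where "\<omega> z = one_form (A (T (k z))) (B (T (k z))) o\<^sub>L L (deriv k z)" for z
  define dA where "dA p h = fst h *\<^sub>R \<partial>\<^sub>x A p + snd h *\<^sub>R \<partial>\<^sub>y A p" for p h
  define dB where "dB p h = fst h *\<^sub>R \<partial>\<^sub>x B p + snd h *\<^sub>R \<partial>\<^sub>y B p" for p h
  \<comment> \<open>The product rule for \<omega>: the first summand differentiates the factor
    \<open>deriv k\<close>, the second the coefficients \<open>A\<close> and
    \<open>B\<close>.\<close>
  define D where "D z h =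
      (one_form (A (T (k z))) (B (T (k z))) o\<^sub>L L (deriv (deriv k) z * h)) +
      (one_form (dA (T (k z)) (T (deriv k z * h))) (dB (T (k z)) (T (deriv k z * h))) o\<^sub>L L (deriv k z))"
    for z h
  have L_derivative: "((\<lambda>z. L (f z)) has_derivative (\<lambda>h. L (f' h))) F" if "(f has_derivative f') F" for f f' F
    unfolding L_def
    by (rule bounded_linear.has_derivative[OF bounded_linear_compose[OF
            bounded_bilinear.bounded_linear_right[OF bounded_bilinear_blinfun_compose]
            bounded_linear_blinfun_mult_right] that])
  have L_continuous: "continuous_on X (\<lambda>x. L (f x))" if "continuous_on X f" for f and X :: "'c::topological_space set"
    unfolding L_def using that by (auto intro!: continuous_intros)
  have "\<exists>F. \<forall>z\<in>S. (F has_derivative \<omega> z) (at z)"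
  proof (rule closed_form_has_primitive_convex[OF S])
    fix z assume z: "z \<in> S"
    have "(k has_field_derivative deriv k z) (at z)" "(deriv k has_field_derivative deriv (deriv k) z) (at z)"
      using k k' S(1) z by (auto intro: holomorphic_derivI)
    note kd = this[unfolded has_field_derivative_def]
    note Tk = bounded_linear.has_derivative[OF T kd(1)]
    have "((\<lambda>z. A (T (k z))) has_derivative (\<lambda>h. dA (T (k z)) (T (deriv k z * h)))) (at z)"
      "((\<lambda>z. B (T (k z))) has_derivative (\<lambda>h. dB (T (k z)) (T (deriv k z * h)))) (at z)"
      unfolding dA_def dB_def
      using TkS[OF z] smooth by (auto intro!: has_derivative_compose[OF Tk] has_derivative_partials
          smooth_on_differentiable)
    then show "(\<omega> has_derivative D z) (at z)"
      unfolding \<omega>_def D_def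
      by (intro bounded_bilinear.FDERIV[OF bounded_bilinear_blinfun_compose] has_derivative_one_form
          L_derivative kd)
    \<comment> \<open>The term with the second derivative of \<open>k\<close> is symmetric because
      complex multiplication commutes; the other is symmetric because the form is closed.\<close>
    show "D z h l = D z l h" for h l
      using closed[OF TkS[OF z]]
      by (simp add: D_def dA_def dB_def blinfun.add_left algebra_simps)
  next
    have comp: "continuous_on (S \<times> UNIV) (\<lambda>x. f (T (k (fst x))))" if "smooth_on U f" for f :: "_ \<Rightarrow> 'b"
      by (rule continuous_on_compose2[OF smooth_on_continuous[OF that]],
          intro continuous_on_compose2[OF cont(1)[of UNIV]]
            continuous_on_compose2[OF holomorphic_on_imp_continuous_on[OF k]])
        (auto intro!: continuous_intros TkS)
    have "continuous_on (S \<times> UNIV) (\<lambda>x. deriv k (fst x))"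
      "continuous_on (S \<times> UNIV) (\<lambda>x. deriv (deriv k) (fst x))"
      using holomorphic_on_imp_continuous_on[OF k'] holomorphic_on_imp_continuous_on[OF holomorphic_deriv[OF k' S(1)]]
      by (auto elim!: continuous_on_compose2 intro!: continuous_intros)
    then show "continuous_on (S \<times> UNIV) (\<lambda>(z, h). D z h)"
      unfolding split_beta D_def dA_def dB_def
      using smooth by (intro continuous_intros L_continuous comp
          continuous_on_compose2[OF cont(1)[of UNIV]]) auto
  qed
  then obtain F where F: "\<And>z. z \<in> S \<Longrightarrow> (F has_derivative \<omega> z) (at z)"
    by blast
  have "((\<lambda>p. F (g (T' p))) has_derivative (\<lambda>h. fst h *\<^sub>R A p + snd h *\<^sub>R B p)) (at p)" if "p \<in> U" for p
  proof -
    have V: "T' p \<in> V" using that by (simp add: V_def)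
    have gd: "(g has_field_derivative deriv g (T' p)) (at (T' p))"
      using g \<open>open V\<close> V by (rule holomorphic_derivI)
    have "(k has_field_derivative deriv k (g (T' p))) (at (g (T' p)))"
      using k S(1) gV[OF V] by (rule holomorphic_derivI)
    from DERIV_chain2[OF this gd]
    have "((\<lambda>w. w) has_field_derivative deriv k (g (T' p)) * deriv g (T' p)) (at (T' p))"
      by (rule has_field_derivative_transform_within_open[OF _ \<open>open V\<close> V]) (simp add: kg)
    \<comment> \<open>Differentiating \<open>k (g w) = w\<close> makes the two complex derivatives
      reciprocal, so pulling back along \<open>g\<close> undoes the pullback along
      \<open>k\<close>.\<close>
    then have inv: "deriv k (g (T' p)) * (deriv g (T' p) * h) = h" for h
      using DERIV_unique[OF DERIV_ident] by (metis mult.assoc mult_1)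
    have "((\<lambda>p. F (g (T' p))) has_derivative (\<lambda>h. \<omega> (g (T' p)) (deriv g (T' p) * T' h))) (at p)"
      using gd unfolding has_field_derivative_def
      by (intro has_derivative_compose[OF has_derivative_compose[OF bounded_linear_imp_has_derivative[OF T']]]
          F gV V)
    then show ?thesis
      by (simp add: \<omega>_def inv kg[OF V])
  qed
  then show ?thesis by blast
qed simp

end

section \<open>The moving frame of a pseudospherical surface\<close>

text \<open>Three orthonormal vectors span the space, so \<open>s - t\<close> is orthogonal to
  everything, in particular to itself.\<close>

lemma orthonormal_triple_eqI:
  fixes u v w :: "real^3"
  assumes "u \<bullet> u = 1" "v \<bullet> v = 1" "w \<bullet> w = 1" "u \<bullet> v = 0" "u \<bullet> w = 0" "v \<bullet> w = 0"
    and "s \<bullet> u = t \<bullet> u" "s \<bullet> v = t \<bullet> v" "s \<bullet> w = t \<bullet> w"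
  shows "s = t"
proof -
  have ne: "u \<noteq> v" "u \<noteq> w" "v \<noteq> w" "0 \<notin> {u, v, w}"
    using assms(1-6) by auto
  have "pairwise orthogonal {u, v, w}"
    using assms(4-6) by (auto simp: pairwise_def orthogonal_def inner_commute)
  then have "independent {u, v, w}"
    using ne by (intro pairwise_orthogonal_independent) auto
  moreover have "card {u, v, w} = dim (UNIV :: (real^3) set)"
    using ne by (simp add: dim_UNIV)
  ultimately have "s - t \<in> span {u, v, w}"
    using card_ge_dim_independent[of "{u, v, w}" UNIV] by auto
  moreover have "orthogonal (s - t) x" if "x \<in> {u, v, w}" for x
    using that assms(7-9) by (auto simp: orthogonal_def inner_diff_left)
  ultimately have "orthogonal (s - t) (s - t)"
    by (rule orthogonal_to_span)
  then show ?thesis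
    by (simp add: orthogonal_def)
qed

text \<open>The source of the frame equations: scalar product relations on \<open>U\<close> are
  differentiated to find components of derivatives.\<close>

lemma (in plane_domain) inner_eq_partials:
  assumes "smooth_on U f" "smooth_on U g" "p \<in> U" "\<And>p. p \<in> U \<Longrightarrow> f p \<bullet> g p = h p"
  shows "\<partial>\<^sub>x f p \<bullet> g p + f p \<bullet> \<partial>\<^sub>x g p = \<partial>\<^sub>x h p"
    and "\<partial>\<^sub>y f p \<bullet> g p + f p \<bullet> \<partial>\<^sub>y g p = \<partial>\<^sub>y h p"
  using partials_inner[OF assms(1-3)] partial_x_cong[OF assms(4,3)] partial_y_cong[OF assms(4,3)]
  by simp_all

locale pseudosphere = plane_domain +
  fixes \<phi> :: "real \<times> real \<Rightarrow> real" and r n :: "real \<times> real \<Rightarrow> real^3"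
  assumes pseudospherical: "pseudospherical_surface U \<phi> r n"
begin

abbreviation "a \<equiv> \<partial>\<^sub>x r"
abbreviation "b \<equiv> \<partial>\<^sub>y r"
abbreviation "m \<equiv> \<partial>\<^sub>x n"

lemma smooth_data [simp]: "smooth_on U \<phi>" "smooth_on U r" "smooth_on U n"
  using pseudospherical by (auto simp: pseudospherical_surface_def)

lemma fundamental_forms:
  assumes "p \<in> U"
  shows "sin (\<phi> p) \<noteq> 0" "n p \<bullet> n p = 1" "n p \<bullet> a p = 0" "n p \<bullet> b p = 0"
    "a p \<bullet> a p = 1" "a p \<bullet> b p = cos (\<phi> p)" "b p \<bullet> b p = 1"
    "\<partial>\<^sub>x a p \<bullet> n p = 0" "\<partial>\<^sub>y a p \<bullet> n p = sin (\<phi> p)" "\<partial>\<^sub>y b p \<bullet> n p = 0"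
  using pseudospherical assms by (auto simp: pseudospherical_surface_def norm_eq_1)

lemma eq_from_inner_n_a_b:
  assumes p: "p \<in> U" and "s \<bullet> n p = t \<bullet> n p" "s \<bullet> a p = t \<bullet> a p" "s \<bullet> b p = t \<bullet> b p"
  shows "s = t"
proof -
  \<comment> \<open>Gram-Schmidt applied to \<open>b p\<close> against \<open>a p\<close>; the
    remainder has squared length sin^2 \<phi>, which is nonzero.\<close>
  define e where "e = (1 / sin (\<phi> p)) *\<^sub>R (b p - cos (\<phi> p) *\<^sub>R a p)"
  note f = fundamental_forms[OF p]
  have "(b p - cos (\<phi> p) *\<^sub>R a p) \<bullet> (b p - cos (\<phi> p) *\<^sub>R a p) = sin (\<phi> p) * sin (\<phi> p)"
    using f sin_cos_squared_add3[of "\<phi> p"] by (simp add: inner_simps inner_commute algebra_simps)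
  then have "e \<bullet> e = 1"
    using f(1) by (simp add: e_def)
  moreover have "n p \<bullet> e = 0" "a p \<bullet> e = 0"
    using f by (simp_all add: e_def inner_simps)
  moreover have "s \<bullet> e = t \<bullet> e"
    using assms by (simp add: e_def inner_simps)
  ultimately show ?thesis
    using assms f by (intro orthonormal_triple_eqI[of "n p" "a p" e]) simp_all
qed

lemma partial_x_b_commute: "p \<in> U \<Longrightarrow> \<partial>\<^sub>x b p = \<partial>\<^sub>y a p"
  by (simp add: mixed_partials)

lemma partial_y_m_commute: "p \<in> U \<Longrightarrow> \<partial>\<^sub>y m p = \<partial>\<^sub>x (\<partial>\<^sub>y n) p"
  by (simp add: mixed_partials)

text \<open>Differentiate the products of \<open>n\<close> with \<open>n\<close>, \<open>a\<close>,
  \<open>b\<close> in x; the second fundamental form gives the remaining terms.\<close>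

lemma inner_m:
  assumes p: "p \<in> U"
  shows "n p \<bullet> m p = 0" "a p \<bullet> m p = 0" "b p \<bullet> m p = - sin (\<phi> p)"
proof -
  note f = fundamental_forms
  show "n p \<bullet> m p = 0"
    using inner_eq_partials(1)[of n n, OF _ _ p f(2)] by (simp add: inner_commute)
  show "a p \<bullet> m p = 0"
    using inner_eq_partials(1)[of n a, OF _ _ p f(3)] f(8)[OF p] by (simp add: inner_commute)
  show "b p \<bullet> m p = - sin (\<phi> p)"
    using inner_eq_partials(1)[of n b, OF _ _ p f(4)] f(9)[OF p] partial_x_b_commute[OF p]
    by (simp add: inner_commute)
qed

text \<open>The Weingarten formula for \<open>m\<close>, solved for \<open>b\<close>; it avoids
  division by sin \<phi>.\<close>

lemma b_eq:
  assumes p: "p \<in> U"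
  shows "b p = cos (\<phi> p) *\<^sub>R a p - sin (\<phi> p) *\<^sub>R m p"
  using fundamental_forms[OF p] inner_m[OF p] sin_cos_squared_add3[of "\<phi> p"]
  by (intro eq_from_inner_n_a_b[OF p]) (simp_all add: inner_simps inner_commute)

text \<open>Pairing \<open>b_eq\<close> with \<open>m p\<close> gives sin \<phi> = sin \<phi> (m .
  m), and sin \<phi> cancels.\<close>

lemma m_unit: "p \<in> U \<Longrightarrow> m p \<bullet> m p = 1"
  using inner_m[of p] fundamental_forms(1)[of p] b_eq[of p] by (simp add: inner_simps)

lemma eq_from_frame:
  assumes "p \<in> U" "s \<bullet> n p = t \<bullet> n p" "s \<bullet> a p = t \<bullet> a p" "s \<bullet> m p = t \<bullet> m p"
  shows "s = t"
  using assms by (intro eq_from_inner_n_a_b[OF assms(1)]) (simp_all add: b_eq inner_simps)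

lemma frame_inner [simp]:
  assumes "p \<in> U"
  shows "n p \<bullet> n p = 1" "a p \<bullet> a p = 1" "m p \<bullet> m p = 1"
    "n p \<bullet> a p = 0" "a p \<bullet> n p = 0" "n p \<bullet> m p = 0" "m p \<bullet> n p = 0" "a p \<bullet> m p = 0" "m p \<bullet> a p = 0"
  using fundamental_forms(2,3,5)[OF assms] inner_m(1,2)[OF assms] m_unit[OF assms]
  by (simp_all add: inner_commute)

text \<open>With \<open>partial_x_m\<close>, these are the Frenet equations of the asymptotic
  x-lines: signed curvature \<open>\<partial>\<^sub>x \<phi>\<close> and torsion of modulus
  1.\<close>

lemma partial_x_a [simp]: 
  assumes p: "p \<in> U"
  shows "\<partial>\<^sub>x a p = \<partial>\<^sub>x \<phi> p *\<^sub>R m p"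
proof (rule eq_from_inner_n_a_b[OF p])
  note f = fundamental_forms
  show "\<partial>\<^sub>x a p \<bullet> n p = (\<partial>\<^sub>x \<phi> p *\<^sub>R m p) \<bullet> n p"
    using p f by simp
  show "\<partial>\<^sub>x a p \<bullet> a p = (\<partial>\<^sub>x \<phi> p *\<^sub>R m p) \<bullet> a p"
    using inner_eq_partials(1)[of a a, OF _ _ p f(5)] p by (simp add: inner_commute)
  \<comment> \<open>By equality of mixed partials this is half the y-derivative of the constant
    \<open>a p \<bullet> a p\<close>.\<close>
  have "a p \<bullet> \<partial>\<^sub>x b p = 0"
    using inner_eq_partials(2)[of a a, OF _ _ p f(5)] partial_x_b_commute[OF p] by (simp add: inner_commute)
  then show "\<partial>\<^sub>x a p \<bullet> b p = (\<partial>\<^sub>x \<phi> p *\<^sub>R m p) \<bullet> b p"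
    using inner_eq_partials(1)[of a b, OF _ _ p f(6)] p inner_m(3)[OF p] by (simp add: inner_commute)
qed

text \<open>Both families of coordinate lines have unit speed, so the mixed derivative of
  \<open>r\<close> is orthogonal to \<open>a\<close> and \<open>b\<close> and hence normal.\<close>

lemma partial_y_a [simp]:
  assumes p: "p \<in> U"
  shows "\<partial>\<^sub>y a p = sin (\<phi> p) *\<^sub>R n p"
proof (rule eq_from_inner_n_a_b[OF p])
  note f = fundamental_forms
  show "\<partial>\<^sub>y a p \<bullet> n p = (sin (\<phi> p) *\<^sub>R n p) \<bullet> n p"
    using p f by simp
  show "\<partial>\<^sub>y a p \<bullet> a p = (sin (\<phi> p) *\<^sub>R n p) \<bullet> a p"
    using inner_eq_partials(2)[of a a, OF _ _ p f(5)] p by (simp add: inner_commute)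
  show "\<partial>\<^sub>y a p \<bullet> b p = (sin (\<phi> p) *\<^sub>R n p) \<bullet> b p"
    using inner_eq_partials(1)[of b b, OF _ _ p f(7)] partial_x_b_commute[OF p] f(4)[OF p] by (simp add: inner_commute)
qed

lemma partial_y_n:
  assumes p: "p \<in> U"
  shows "\<partial>\<^sub>y n p = - sin (\<phi> p) *\<^sub>R a p - cos (\<phi> p) *\<^sub>R m p"
proof (rule eq_from_inner_n_a_b[OF p])
  note f = fundamental_forms
  show "\<partial>\<^sub>y n p \<bullet> n p = (- sin (\<phi> p) *\<^sub>R a p - cos (\<phi> p) *\<^sub>R m p) \<bullet> n p"
    using inner_eq_partials(2)[of n n, OF _ _ p f(2)] p by (simp add: inner_simps inner_commute)
  show "\<partial>\<^sub>y n p \<bullet> a p = (- sin (\<phi> p) *\<^sub>R a p - cos (\<phi> p) *\<^sub>R m p) \<bullet> a p"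
    using inner_eq_partials(2)[of n a, OF _ _ p f(3)] p by (simp add: inner_simps)
  show "\<partial>\<^sub>y n p \<bullet> b p = (- sin (\<phi> p) *\<^sub>R a p - cos (\<phi> p) *\<^sub>R m p) \<bullet> b p"
    using inner_eq_partials(2)[of n b, OF _ _ p f(4)] f(6,10)[OF p] p inner_m(3)[OF p]
    by (simp add: inner_simps inner_commute)
qed

text \<open>By orthonormality the components along \<open>n\<close> and \<open>a\<close> are the
  negatives of the m-components of \<open>\<partial>\<^sub>x n\<close> and
  \<open>\<partial>\<^sub>x a\<close>; \<open>partial_y_m\<close> follows the same pattern.\<close>

lemma partial_x_m [simp]:
  assumes p: "p \<in> U"
  shows "\<partial>\<^sub>x m p = - n p - \<partial>\<^sub>x \<phi> p *\<^sub>R a p"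
proof (rule eq_from_frame[OF p])
  show "\<partial>\<^sub>x m p \<bullet> n p = (- n p - \<partial>\<^sub>x \<phi> p *\<^sub>R a p) \<bullet> n p"
    using inner_eq_partials(1)[of m n, OF _ _ p frame_inner(7)] p by (simp add: inner_simps)
  show "\<partial>\<^sub>x m p \<bullet> a p = (- n p - \<partial>\<^sub>x \<phi> p *\<^sub>R a p) \<bullet> a p"
    using inner_eq_partials(1)[of m a, OF _ _ p frame_inner(9)] p by (simp add: inner_simps)
  show "\<partial>\<^sub>x m p \<bullet> m p = (- n p - \<partial>\<^sub>x \<phi> p *\<^sub>R a p) \<bullet> m p"
    using inner_eq_partials(1)[of m m, OF _ _ p frame_inner(3)] p by (simp add: inner_simps inner_commute)
qed

lemma partial_y_m [simp]:
  assumes p: "p \<in> U"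
  shows "\<partial>\<^sub>y m p = cos (\<phi> p) *\<^sub>R n p"
proof (rule eq_from_frame[OF p])
  show "\<partial>\<^sub>y m p \<bullet> n p = (cos (\<phi> p) *\<^sub>R n p) \<bullet> n p"
    using inner_eq_partials(2)[of m n, OF _ _ p frame_inner(7)] p by (simp add: inner_simps partial_y_n)
  show "\<partial>\<^sub>y m p \<bullet> a p = (cos (\<phi> p) *\<^sub>R n p) \<bullet> a p"
    using inner_eq_partials(2)[of m a, OF _ _ p frame_inner(9)] p by (simp add: inner_simps)
  show "\<partial>\<^sub>y m p \<bullet> m p = (cos (\<phi> p) *\<^sub>R n p) \<bullet> m p"
    using inner_eq_partials(2)[of m m, OF _ _ p frame_inner(3)] p by (simp add: inner_simps inner_commute)
qed

text \<open>The compatibility condition of the frame: \<open>\<partial>\<^sub>x \<phi>\<close> is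
  the m-component of \<open>\<partial>\<^sub>x a\<close>, and its y-derivative is read off after
  exchanging the derivatives of \<open>a\<close>.\<close>

lemma sine_gordon [simp]:
  assumes p: "p \<in> U"
  shows "\<partial>\<^sub>y (\<partial>\<^sub>x \<phi>) p = sin (\<phi> p)" "\<partial>\<^sub>x (\<partial>\<^sub>y \<phi>) p = sin (\<phi> p)"
proof -
  have "\<partial>\<^sub>y (\<partial>\<^sub>x a) p = \<partial>\<^sub>x (\<partial>\<^sub>y a) p"
    using p by (intro mixed_partials) simp_all
  also have "\<dots> = \<partial>\<^sub>x (\<lambda>p. sin (\<phi> p) *\<^sub>R n p) p"
    using p by (intro partial_x_cong) simp_all
  also have "\<dots> = (cos (\<phi> p) * \<partial>\<^sub>x \<phi> p) *\<^sub>R n p + sin (\<phi> p) *\<^sub>R m p"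
    using p by simp
  finally have *: "\<partial>\<^sub>y (\<partial>\<^sub>x a) p = (cos (\<phi> p) * \<partial>\<^sub>x \<phi> p) *\<^sub>R n p + sin (\<phi> p) *\<^sub>R m p" .
  have "\<partial>\<^sub>y (\<partial>\<^sub>x a) p \<bullet> m p + \<partial>\<^sub>x a p \<bullet> \<partial>\<^sub>y m p = \<partial>\<^sub>y (\<partial>\<^sub>x \<phi>) p"
    by (rule inner_eq_partials(2)[OF _ _ p]) simp_all
  then show "\<partial>\<^sub>y (\<partial>\<^sub>x \<phi>) p = sin (\<phi> p)"
    using p by (simp add: * inner_simps)
  then show "\<partial>\<^sub>x (\<partial>\<^sub>y \<phi>) p = sin (\<phi> p)"
    using mixed_partials[OF smooth_data(1) p] by simp
qed

lemma partial_x_b [simp]: "p \<in> U \<Longrightarrow> \<partial>\<^sub>x b p = sin (\<phi> p) *\<^sub>R n p"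
  by (simp add: partial_x_b_commute)

text \<open>Differentiating \<open>b_eq\<close>, the normal contributions of
  \<open>\<partial>\<^sub>y a\<close> and \<open>\<partial>\<^sub>y m\<close> cancel and only the
  rotation by \<phi> remains.\<close>

lemma partial_y_b [simp]:
  assumes p: "p \<in> U"
  shows "\<partial>\<^sub>y b p = - \<partial>\<^sub>y \<phi> p *\<^sub>R (sin (\<phi> p) *\<^sub>R a p + cos (\<phi> p) *\<^sub>R m p)"
proof -
  have "\<partial>\<^sub>y b p = \<partial>\<^sub>y (\<lambda>p. cos (\<phi> p) *\<^sub>R a p - sin (\<phi> p) *\<^sub>R m p) p"
    using p b_eq by (rule partial_y_cong[rotated])
  then show ?thesis
    using p by (simp add: algebra_simps)
qed

lemma partial_x_y_n [simp]: "p \<in> U \<Longrightarrow> \<partial>\<^sub>x (\<partial>\<^sub>y n) p = cos (\<phi> p) *\<^sub>R n p"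
  by (simp flip: partial_y_m_commute)

text \<open>The mirror image of \<open>partial_x_m\<close> under exchange of x and y.\<close>

lemma partial_y_y_n [simp]:
  assumes p: "p \<in> U"
  shows "\<partial>\<^sub>y (\<partial>\<^sub>y n) p = - n p - \<partial>\<^sub>y \<phi> p *\<^sub>R b p"
proof -
  have "\<partial>\<^sub>y (\<partial>\<^sub>y n) p = \<partial>\<^sub>y (\<lambda>p. - sin (\<phi> p) *\<^sub>R a p - cos (\<phi> p) *\<^sub>R m p) p"
    using p partial_y_n by (rule partial_y_cong[rotated])
  also have "\<dots> = - ((cos (\<phi> p) * cos (\<phi> p)) *\<^sub>R n p + (sin (\<phi> p) * sin (\<phi> p)) *\<^sub>R n p) - \<partial>\<^sub>y \<phi> p *\<^sub>R b p"
    using p by (simp add: b_eq algebra_simps)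
  also have "\<dots> = - n p - \<partial>\<^sub>y \<phi> p *\<^sub>R b p"
    by (simp add: sin_cos_squared_add3 flip: scaleR_left_distrib)
  finally show ?thesis .
qed

end

section \<open>The system for the vector potential\<close>

locale pseudosphere_vector = pseudosphere +
  fixes c :: "real^3"
begin

text \<open>\<open>A\<close> and \<open>B\<close> are the bracketed scalars of the system.
  \<open>K\<close> and \<open>H\<close> carry their singular factors, and \<open>K\<close> is also
  the offset between the potential \<open>Q\<close> and \<open>a p \<bullet> q p\<close>.\<close>

definition "K p = \<partial>\<^sub>y n p \<bullet> c / sin (\<phi> p)"
definition "H p = m p \<bullet> c / sin (\<phi> p)"
definition "A p = n p \<bullet> c - \<partial>\<^sub>x \<phi> p * K p"
definition "B p = n p \<bullet> c - \<partial>\<^sub>y \<phi> p * H p"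

lemma smooth_K_H [simp]: "smooth_on U K" "smooth_on U H"
  unfolding K_def H_def by (simp_all add: fundamental_forms(1))

lemma smooth_A_B [simp]: "smooth_on U A" "smooth_on U B"
  unfolding A_def B_def by simp_all

text \<open>In terms of \<open>K\<close> and \<open>H\<close> the tangential products with
  \<open>c\<close> are free of denominators.\<close>

lemma inner_c:
  assumes "p \<in> U"
  shows "\<partial>\<^sub>y n p \<bullet> c = sin (\<phi> p) * K p" "m p \<bullet> c = sin (\<phi> p) * H p"
    and "a p \<bullet> c = - K p - cos (\<phi> p) * H p" and "b p \<bullet> c = - H p - cos (\<phi> p) * K p"
proof -
  note sin = fundamental_forms(1)[OF assms]
  show y: "\<partial>\<^sub>y n p \<bullet> c = sin (\<phi> p) * K p" and x: "m p \<bullet> c = sin (\<phi> p) * H p"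
    using sin by (simp_all add: K_def H_def)
  have "sin (\<phi> p) * K p = - sin (\<phi> p) * (a p \<bullet> c) - cos (\<phi> p) * (sin (\<phi> p) * H p)"
    using y x partial_y_n[OF assms] by (simp add: inner_simps)
  then have "sin (\<phi> p) * (a p \<bullet> c) = sin (\<phi> p) * (- K p - cos (\<phi> p) * H p)"
    by (simp add: algebra_simps)
  then show ac: "a p \<bullet> c = - K p - cos (\<phi> p) * H p"
    using sin by simp
  have "cos (\<phi> p) * cos (\<phi> p) * H p + sin (\<phi> p) * sin (\<phi> p) * H p = H p"
    by (simp add: sin_cos_squared_add3 flip: distrib_right)
  then show "b p \<bullet> c = - H p - cos (\<phi> p) * K p"
    unfolding b_eq[OF assms] by (simp add: inner_simps x ac algebra_simps)
qed

text \<open>The second derivatives of \<open>n\<close> and the derivative of sin \<phi> recombine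
  into \<open>A\<close> or \<open>B\<close>. In \<open>\<partial>\<^sub>y K\<close>, for example,
  the K-part of \<open>b p \<bullet> c\<close> cancels the term from sin \<phi>.\<close>

lemma partials_K_H:
  assumes "p \<in> U"
  shows "\<partial>\<^sub>x K p = cos (\<phi> p) / sin (\<phi> p) * A p" "\<partial>\<^sub>y K p = - B p / sin (\<phi> p)"
    and "\<partial>\<^sub>x H p = - A p / sin (\<phi> p)" "\<partial>\<^sub>y H p = cos (\<phi> p) / sin (\<phi> p) * B p"
  unfolding K_def H_def
  using assms fundamental_forms(1)[OF assms]
  by (simp_all add: partials_divide inner_simps inner_c)
    (simp_all add: A_def B_def field_simps)

text \<open>By sine-Gordon the derivative of \<open>n p \<bullet> c\<close> cancels the mixed
  derivative of \<phi> times \<open>K\<close> or \<open>H\<close>.\<close>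

lemma partials_A_B:
  assumes "p \<in> U"
  shows "\<partial>\<^sub>y A p = \<partial>\<^sub>x \<phi> p * B p / sin (\<phi> p)" "\<partial>\<^sub>x B p = \<partial>\<^sub>y \<phi> p * A p / sin (\<phi> p)"
  unfolding A_def[abs_def] B_def[abs_def]
  using assms by (simp_all add: inner_c partials_K_H)
    (simp_all add: A_def B_def)

section \<open>Integrability of the system and uniqueness up to constants\<close>

lemma q1_system_iff:
  "q1_system U \<phi> r n c q \<longleftrightarrow> smooth_on U q \<and> (\<forall>p\<in>U.
      \<partial>\<^sub>x q p = - (A p / sin (\<phi> p)) *\<^sub>R b p \<and> \<partial>\<^sub>y q p = (B p / sin (\<phi> p)) *\<^sub>R a p)"
  unfolding q1_system_def
  by (auto simp: A_def B_def K_def H_def inner_simps divide_inverse mult_ac)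

lemma q1_system_has_derivative:
  assumes "q1_system U \<phi> r n c q" "p \<in> U"
  shows "(q has_derivative (\<lambda>h. fst h *\<^sub>R (- (A p / sin (\<phi> p)) *\<^sub>R b p) + snd h *\<^sub>R ((B p / sin (\<phi> p)) *\<^sub>R a p))) (at p)"
  using assms has_derivative_partials[OF smooth_on_differentiable[of q p]]
  by (simp add: q1_system_iff)

lemma q1_compatibility:
  assumes p: "p \<in> U"
  shows "\<partial>\<^sub>y (\<lambda>p. - (A p / sin (\<phi> p)) *\<^sub>R b p) p = \<partial>\<^sub>x (\<lambda>p. (B p / sin (\<phi> p)) *\<^sub>R a p) p"
proof -
  define s k where "s = sin (\<phi> p)" and "k = cos (\<phi> p)"
  have s: "s \<noteq> 0" and sk: "k * k + s * s = 1"
    using fundamental_forms(1)[OF p] by (simp_all add: s_def k_def sin_cos_squared_add3)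
  have smooth: "smooth_on U (\<lambda>p. A p / sin (\<phi> p))" "smooth_on U (\<lambda>p. B p / sin (\<phi> p))"
    by (simp_all add: fundamental_forms(1))
  have "\<partial>\<^sub>y (\<lambda>p. - (A p / sin (\<phi> p)) *\<^sub>R b p) p =
      - ((\<partial>\<^sub>x \<phi> p * B p / s - A p / s * (k * \<partial>\<^sub>y \<phi> p)) / s) *\<^sub>R (k *\<^sub>R a p - s *\<^sub>R m p)
      + (A p / s * \<partial>\<^sub>y \<phi> p) *\<^sub>R (s *\<^sub>R a p + k *\<^sub>R m p)"
    using p s smooth smooth_on_minus[OF smooth(1)]
    by (simp add: partials_divide partials_A_B b_eq s_def k_def)
  \<comment> \<open>Both sides are tangential, so only the components along \<open>a\<close> and
    \<open>m\<close> have content; the first needs sin^2 + cos^2 = 1.\<close>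
  also have "\<dots> = ((\<partial>\<^sub>y \<phi> p * A p / s - B p / s * (k * \<partial>\<^sub>x \<phi> p)) / s) *\<^sub>R a p
      + (B p / s * \<partial>\<^sub>x \<phi> p) *\<^sub>R m p"
  proof (rule eq_from_frame[OF p])
    have *: "\<partial>\<^sub>y \<phi> p * A p = \<partial>\<^sub>y \<phi> p * A p * (k * k) + \<partial>\<^sub>y \<phi> p * A p * (s * s)"
      by (simp add: sk flip: distrib_left)
    show "(- ((\<partial>\<^sub>x \<phi> p * B p / s - A p / s * (k * \<partial>\<^sub>y \<phi> p)) / s) *\<^sub>R (k *\<^sub>R a p - s *\<^sub>R m p)
        + (A p / s * \<partial>\<^sub>y \<phi> p) *\<^sub>R (s *\<^sub>R a p + k *\<^sub>R m p)) \<bullet> a p =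
      (((\<partial>\<^sub>y \<phi> p * A p / s - B p / s * (k * \<partial>\<^sub>x \<phi> p)) / s) *\<^sub>R a p + (B p / s * \<partial>\<^sub>x \<phi> p) *\<^sub>R m p) \<bullet> a p"
      using p s * by (simp add: inner_simps field_simps)
  qed (use p s in \<open>simp_all add: inner_simps field_simps\<close>)
  also have "\<dots> = \<partial>\<^sub>x (\<lambda>p. (B p / sin (\<phi> p)) *\<^sub>R a p) p"
    using p s smooth by (simp add: partials_divide partials_A_B s_def k_def)
  finally show ?thesis .
qed

lemma q1_system_exists:
  assumes "simply_connected U"
  shows "\<exists>q. q1_system U \<phi> r n c q"
proof -
  have smooth: "smooth_on U (\<lambda>p. - (A p / sin (\<phi> p)) *\<^sub>R b p)" "smooth_on U (\<lambda>p. (B p / sin (\<phi> p)) *\<^sub>R a p)"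
    by (simp_all add: fundamental_forms(1) del: scaleR_minus_left)
  obtain q where q: "\<And>p. p \<in> U \<Longrightarrow> (q has_derivative
      (\<lambda>h. fst h *\<^sub>R (- (A p / sin (\<phi> p)) *\<^sub>R b p) + snd h *\<^sub>R ((B p / sin (\<phi> p)) *\<^sub>R a p))) (at p)"
    using closed_form_has_primitive[OF assms smooth q1_compatibility] by blast
  then have "q1_system U \<phi> r n c q"
    unfolding q1_system_iff
    using smooth_onI[OF q smooth] partials_of_has_derivative[OF q] by simp
  then show ?thesis by blast
qed

text \<open>The right-hand sides do not involve \<open>q\<close>, so the difference of two solutions
  has zero derivative on the connected set \<open>U\<close>.\<close>

lemma q1_system_solutions:
  assumes "connected U" "q1_system U \<phi> r n c q\<^sub>0"
  shows "q1_system U \<phi> r n c q \<longleftrightarrow> (\<exists>d. \<forall>p\<in>U. q p = q\<^sub>0 p + d)"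
proof
  assume q: "q1_system U \<phi> r n c q"
  have "((\<lambda>p. q p - q\<^sub>0 p) has_derivative (\<lambda>h. 0)) (at p)" if "p \<in> U" for p
    using has_derivative_diff[OF q1_system_has_derivative[OF q that]
        q1_system_has_derivative[OF assms(2) that]] by simp
  then have "q p - q\<^sub>0 p = q p' - q\<^sub>0 p'" if "p \<in> U" "p' \<in> U" for p p'
    using has_derivative_zero_unique_connected[OF open_U assms(1), of "\<lambda>p. q p - q\<^sub>0 p"] that by blast
  then show "\<exists>d. \<forall>p\<in>U. q p = q\<^sub>0 p + d"
    by (metis add.commute diff_add_cancel)
next
  assume "\<exists>d. \<forall>p\<in>U. q p = q\<^sub>0 p + d"
  then obtain d where d: "\<And>p. p \<in> U \<Longrightarrow> q p = q\<^sub>0 p + d" by blast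
  have q0: "smooth_on U q\<^sub>0"
    using assms(2) by (simp add: q1_system_iff)
  have "smooth_on U q"
    using smooth_on_cong[OF d] q0 by simp
  moreover have "\<partial>\<^sub>x q p = \<partial>\<^sub>x q\<^sub>0 p" "\<partial>\<^sub>y q p = \<partial>\<^sub>y q\<^sub>0 p" if "p \<in> U" for p
    using partial_x_cong[OF d that] partial_y_cong[OF d that] q0 that by simp_all
  ultimately show "q1_system U \<phi> r n c q"
    using assms(2) by (simp add: q1_system_iff)
qed

section \<open>Equivalence of the system with the inverse recursion relation\<close>

lemma q1_system_imp_recursion:
  assumes q: "q1_system U \<phi> r n c q" and \<Phi>: "\<And>p. p \<in> U \<Longrightarrow> \<Phi> p = n p \<bullet> q p"
  shows "(\<Phi>, \<lambda>p. n p \<bullet> c) \<in> plus_Id (recursion_op U \<phi>)"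
proof -
  have smooth_q [simp]: "smooth_on U q"
    and qx [simp]: "\<And>p. p \<in> U \<Longrightarrow> \<partial>\<^sub>x q p = - (A p / sin (\<phi> p)) *\<^sub>R b p"
    and qy [simp]: "\<And>p. p \<in> U \<Longrightarrow> \<partial>\<^sub>y q p = (B p / sin (\<phi> p)) *\<^sub>R a p"
    using q by (simp_all add: q1_system_iff)
  have [simp]: "smooth_on U \<Phi>"
    using smooth_on_cong[OF \<Phi>] by simp
  \<comment> \<open>The term with \<open>\<partial>\<^sub>x q\<close> drops out because
    \<open>b\<close> is orthogonal to \<open>n\<close>; in the mixed derivative below,
    \<open>\<partial>\<^sub>y q\<close> drops out because \<open>a\<close> is orthogonal to
    \<open>m\<close>.\<close>
  have \<Phi>x: "\<partial>\<^sub>x \<Phi> p = m p \<bullet> q p" if "p \<in> U" for p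
    using partial_x_cong[OF \<Phi> that] that by (simp add: fundamental_forms(4))
  have \<Phi>xy: "\<partial>\<^sub>y (\<partial>\<^sub>x \<Phi>) p = \<Phi> p * cos (\<phi> p)" if "p \<in> U" for p
    using partial_y_cong[OF \<Phi>x that] that by (simp add: \<Phi>)
  \<comment> \<open>The product of \<open>m p\<close> with \<open>\<partial>\<^sub>x q p\<close> is
    exactly \<open>A p\<close>, since \<open>b p \<bullet> m p\<close> is - sin \<phi>.\<close>
  have \<Phi>xx: "\<partial>\<^sub>x (\<partial>\<^sub>x \<Phi>) p = - \<Phi> p - \<partial>\<^sub>x \<phi> p * (a p \<bullet> q p) + A p" if "p \<in> U" for p
    using partial_x_cong[OF \<Phi>x that] that inner_m(3)[OF that] fundamental_forms(1)[OF that]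
    by (simp add: \<Phi> inner_simps inner_commute)
  \<comment> \<open>Inserting the formula for the second x-derivative into the recursion equation
    suggests this potential: the offset \<open>K p\<close> restores \<open>n p \<bullet> c\<close>
    from \<open>A p\<close>.\<close>
  define Q where "Q p = a p \<bullet> q p + K p" for p
  have "smooth_on U Q"
    unfolding Q_def by simp
  moreover have "\<partial>\<^sub>x Q p = \<partial>\<^sub>x \<Phi> p * \<partial>\<^sub>x \<phi> p" "\<partial>\<^sub>y Q p = \<Phi> p * sin (\<phi> p)"
    "n p \<bullet> c - \<Phi> p = \<partial>\<^sub>x (\<partial>\<^sub>x \<Phi>) p + \<partial>\<^sub>x \<phi> p * Q p" if "p \<in> U" for p
  proof -
    show "\<partial>\<^sub>x Q p = \<partial>\<^sub>x \<Phi> p * \<partial>\<^sub>x \<phi> p"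
      unfolding Q_def using that fundamental_forms(6)[OF that] by (simp add: \<Phi>x partials_K_H)
    show "\<partial>\<^sub>y Q p = \<Phi> p * sin (\<phi> p)"
      unfolding Q_def using that by (simp add: \<Phi> partials_K_H)
    show "n p \<bullet> c - \<Phi> p = \<partial>\<^sub>x (\<partial>\<^sub>x \<Phi>) p + \<partial>\<^sub>x \<phi> p * Q p"
      using that by (simp add: \<Phi>xx Q_def A_def algebra_simps)
  qed
  \<comment> \<open>The value is written as this difference because \<open>plus_Id\<close> compares
    total functions, whereas the formula with \<open>Q\<close> holds only on
    \<open>U\<close>.\<close>
  ultimately have "(\<Phi>, \<lambda>p. n p \<bullet> c - \<Phi> p) \<in> recursion_op U \<phi>"
    unfolding recursion_op_def moutard_solution_def using \<Phi>xy by auto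
  then show ?thesis
    unfolding plus_Id_def by force
qed

text \<open>The vector \<open>q\<close> is read off from the forward direction: its components in the orthonormal
  frame \<open>n\<close>, \<open>r\<^sub>x\<close>, \<open>n\<^sub>x\<close> must be \<open>\<Phi>\<close>, \<open>Q - K\<close> and \<open>\<Phi>\<^sub>x\<close>.\<close>

lemma recursion_imp_q1_system:
  assumes "(\<Phi>, \<lambda>p. n p \<bullet> c) \<in> plus_Id (recursion_op U \<phi>)"
  shows "\<exists>q. q1_system U \<phi> r n c q \<and> (\<forall>p\<in>U. \<Phi> p = n p \<bullet> q p)"
proof -
  obtain Q where [simp]: "smooth_on U \<Phi>" "smooth_on U Q"
    and \<Phi>xy [simp]: "\<And>p. p \<in> U \<Longrightarrow> \<partial>\<^sub>y (\<partial>\<^sub>x \<Phi>) p = \<Phi> p * cos (\<phi> p)"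
    and Qx [simp]: "\<And>p. p \<in> U \<Longrightarrow> \<partial>\<^sub>x Q p = \<partial>\<^sub>x \<Phi> p * \<partial>\<^sub>x \<phi> p"
    and Qy [simp]: "\<And>p. p \<in> U \<Longrightarrow> \<partial>\<^sub>y Q p = \<Phi> p * sin (\<phi> p)"
    and nc: "\<And>p. p \<in> U \<Longrightarrow> n p \<bullet> c = \<partial>\<^sub>x (\<partial>\<^sub>x \<Phi>) p + \<partial>\<^sub>x \<phi> p * Q p + \<Phi> p"
    using assms unfolding plus_Id_def recursion_op_def moutard_solution_def
    by (auto simp: fun_eq_iff)
  have \<Phi>xxy: "\<partial>\<^sub>y (\<partial>\<^sub>x (\<partial>\<^sub>x \<Phi>)) p = \<partial>\<^sub>x \<Phi> p * cos (\<phi> p) - \<Phi> p * sin (\<phi> p) * \<partial>\<^sub>x \<phi> p" if "p \<in> U" for p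
    using mixed_partials[of "\<partial>\<^sub>x \<Phi>", OF _ that] partial_x_cong[OF \<Phi>xy that] that by simp
  \<comment> \<open>The y-derivative of \<open>nc\<close>; the two terms with
    \<open>\<Phi> p * sin (\<phi> p) * \<partial>\<^sub>x \<phi> p\<close> cancel and sine-Gordon
    produces the factor of \<open>Q p\<close>.\<close>
  have \<Phi>y: "\<partial>\<^sub>y \<Phi> p = sin (\<phi> p) * (K p - Q p) - cos (\<phi> p) * \<partial>\<^sub>x \<Phi> p" if "p \<in> U" for p
    using partial_y_cong[of "\<lambda>p. n p \<bullet> c", OF nc that] that by (simp add: inner_c \<Phi>xxy algebra_simps)
  define q where "q p = \<Phi> p *\<^sub>R n p + (Q p - K p) *\<^sub>R a p + \<partial>\<^sub>x \<Phi> p *\<^sub>R m p" for p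
  have "smooth_on U q"
    unfolding q_def by simp
  moreover have "\<partial>\<^sub>x q p = - (A p / sin (\<phi> p)) *\<^sub>R b p" if "p \<in> U" for p
  proof -
    have A: "A p = \<partial>\<^sub>x (\<partial>\<^sub>x \<Phi>) p + \<Phi> p + \<partial>\<^sub>x \<phi> p * (Q p - K p)"
      using nc[OF that] by (simp add: A_def algebra_simps)
    \<comment> \<open>The normal component cancels identically, the m-component is
      \<open>A p\<close> by the recursion equation, and the a-component is the negative of
      \<open>\<partial>\<^sub>x K p\<close>.\<close>
    have "\<partial>\<^sub>x q p = - (cos (\<phi> p) / sin (\<phi> p) * A p) *\<^sub>R a p + A p *\<^sub>R m p"
      unfolding q_def using that by (simp add: partials_K_H A algebra_simps)
    then show ?thesis
      unfolding b_eq[OF that] using fundamental_forms(1)[OF that] by (simp add: algebra_simps)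
  qed
  \<comment> \<open>The normal component vanishes by the formula for
    \<open>\<partial>\<^sub>y \<Phi>\<close>, the m-component by the Moutard equation; the
    a-component is the negative of \<open>\<partial>\<^sub>y K p\<close>.\<close>
  moreover have "\<partial>\<^sub>y q p = (B p / sin (\<phi> p)) *\<^sub>R a p" if "p \<in> U" for p
    unfolding q_def using that by (simp add: partials_K_H \<Phi>y partial_y_n algebra_simps)
  moreover have "\<Phi> p = n p \<bullet> q p" if "p \<in> U" for p
    unfolding q_def using that by (simp add: inner_simps)
  ultimately show ?thesis
    unfolding q1_system_iff by blast
qed

end

text \<open>The values of the inverse form the image of the singleton under the converse relation.
  The second conjunct contains existence, by taking \<open>d = 0\<close>, as well as uniqueness up
  to a constant.\<close>

theorem proposition7p7:
  fixes U :: "(real \<times> real) set"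
    and \<phi> :: "real \<times> real \<Rightarrow> real"
    and r n :: "real \<times> real \<Rightarrow> real^3"
    and c :: "real^3"
  assumes "open U" and "connected U" and "simply_connected U"
    and "pseudospherical_surface U \<phi> r n"
  shows "(plus_Id (recursion_op U \<phi>))\<inverse> `` {\<lambda>p. n p \<bullet> c} =
           {\<Phi>. \<exists>q\<^sub>1. q1_system U \<phi> r n c q\<^sub>1 \<and> (\<forall>p\<in>U. \<Phi> p = n p \<bullet> q\<^sub>1 p)} \<and>
         (\<exists>q\<^sub>0. {q. q1_system U \<phi> r n c q} = {q. \<exists>d. \<forall>p\<in>U. q p = q\<^sub>0 p + d})"
proof -
  interpret pseudosphere_vector U \<phi> r n c
    using assms(1,4) by unfold_locales
  show ?thesis
  proof
    show "(plus_Id (recursion_op U \<phi>))\<inverse> `` {\<lambda>p. n p \<bullet> c} =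
        {\<Phi>. \<exists>q\<^sub>1. q1_system U \<phi> r n c q\<^sub>1 \<and> (\<forall>p\<in>U. \<Phi> p = n p \<bullet> q\<^sub>1 p)}"
      using recursion_imp_q1_system q1_system_imp_recursion by fastforce
    obtain q\<^sub>0 where "q1_system U \<phi> r n c q\<^sub>0"
      using q1_system_exists[OF assms(3)] by blast
    then show "\<exists>q\<^sub>0. {q. q1_system U \<phi> r n c q} = {q. \<exists>d. \<forall>p\<in>U. q p = q\<^sub>0 p + d}"
      using q1_system_solutions[OF assms(2)] by blast
  qed
qed

end
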